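(* Let $u\in A_\theta^\infty$ be unitary. Then $u$ is harmonic if and only if $$u^*(\Delta u)+(\delta_1(u))^*\,\delta_1(u)+(\delta_2(u))^*\,\delta_2(u)=0.$$
   Context: Fix $\theta\in\mathbb R\smallsetminus\mathbb Q$. $A_\theta$ is the (universal) unital $C^*$-algebra generated by two unitaries $U,V$ with $UV=e^{2\pi i\theta}VU$; $\tau$ is its unique tracial state, given by $\tau(U^mV^n)=0$ for $(m,n)\neq(0,0)$ and $\tau(1)=1$. Its smooth subalgebra is $A_\theta^\infty=\{\sum_{m,n\in\mathbb Z}c_{m,n}U^mV^n: (c_{m,n})\text{ rapidly decreasing}\}$. The commuting derivations $\delta_1,\delta_2$ of $A_\theta^\infty$ are given by $\delta_1(U)=2\pi iU$, $\delta_1(V)=0$, $\delta_2(U)=0$, $\delta_2(V)=2\pi iV$, so $\delta_1(\sum c_{m,n}U^mV^n)=2\pi i\sum m\,c_{m,n}U^mV^n$ and $\delta_2(\sum c_{m,n}U^mV^n)=2\pi i\sum n\,c_{m,n}U^mV^n$. The Laplacian is $\Delta=\delta_1^2+\delta_2^2$. Write $U(A_\theta^\infty)$ for the group of unitaries in $A_\theta^\infty$. The energy of $u\in U(A_\theta^\infty)$ is $E(u)=\tfrac12\tau\bigl((\delta_1(u))^*\delta_1(u)+(\delta_2(u))^*\delta_2(u)\bigr)$. The unitary $u$ is called harmonic if it is a critical point of $E:U(A_\theta^\infty)\to[0,\infty)$, i.e. $\frac{d}{dt}\big|_{t=0}E(ue^{ith})=0$ for every $h=h^*\in A_\theta^\infty$.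 *)

theory Defs
  imports "HOL-Analysis.Analysis" "HOL-Algebra.Ring"
begin

section \<open>Unital \<open>C\<^sup>*\<close>-algebras\<close>

text \<open>
  Nonzero unital \<open>C\<^sup>*\<close>-algebras as a type class. The real Banach algebra structure comes from
  the library (so that \<^const>\<open>exp\<close>, \<^const>\<open>has_sum\<close>, \<^const>\<open>infsum\<close> are available).
\<close>

class cstar_algebra = real_normed_algebra_1 + banach +
  fixes scaleC :: "complex \<Rightarrow> 'a \<Rightarrow> 'a"  (infixr "*\<^sub>C" 75)
    and star :: "'a \<Rightarrow> 'a"
  assumes scaleC_add_right: "c *\<^sub>C (x + y) = c *\<^sub>C x + c *\<^sub>C y"
    and scaleC_add_left: "(c + d) *\<^sub>C x = c *\<^sub>C x + d *\<^sub>C x"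
    and scaleC_scaleC: "c *\<^sub>C d *\<^sub>C x = (c * d) *\<^sub>C x"
    and scaleC_of_real: "complex_of_real r *\<^sub>C x = r *\<^sub>R x"
    and mult_scaleC_left: "(c *\<^sub>C x) * y = c *\<^sub>C (x * y)"
    and mult_scaleC_right: "x * (c *\<^sub>C y) = c *\<^sub>C (x * y)"
    and norm_scaleC: "norm (c *\<^sub>C x) = cmod c * norm x"
    and star_add: "star (x + y) = star x + star y"
    and star_scaleC: "star (c *\<^sub>C x) = cnj c *\<^sub>C star x"
    and star_mult: "star (x * y) = star y * star x"
    and star_star: "star (star x) = x"
    and cstar_identity: "norm (star x * x) = (norm x)\<^sup>2"

definition unitary :: "'a::cstar_algebra \<Rightarrow> bool" where
  "unitary u \<longleftrightarrow> star u * u = 1 \<and> u * star u = 1"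

definition tracial_state :: "('a::cstar_algebra \<Rightarrow> complex) \<Rightarrow> bool" where
  "tracial_state \<tau> \<longleftrightarrow>
     bounded_linear \<tau> \<and> (\<forall>c x. \<tau> (c *\<^sub>C x) = c * \<tau> x) \<and>
     (\<forall>x. \<tau> (star x * x) \<in> \<real>\<^sub>\<ge>\<^sub>0) \<and> \<tau> 1 = 1 \<and>
     (\<forall>x y. \<tau> (x * y) = \<tau> (y * x))"

text \<open>
  The same notion with an explicit carrier (the zero algebra being allowed), needed because a
  universal property has to quantify over algebras inside a formula.
\<close>

record 'b cstar_ring = "'b ring" +
  csmult :: "complex \<Rightarrow> 'b \<Rightarrow> 'b"
  cadj :: "'b \<Rightarrow> 'b"
  cnorm :: "'b \<Rightarrow> real"

locale cstar_algebra_on = ring B for B :: "'b cstar_ring" (structure) +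
  assumes csmult_closed: "x \<in> carrier B \<Longrightarrow> csmult B c x \<in> carrier B"
    and csmult_add_right: "\<lbrakk>x \<in> carrier B; y \<in> carrier B\<rbrakk> \<Longrightarrow>
          csmult B c (x \<oplus> y) = csmult B c x \<oplus> csmult B c y"
    and csmult_add_left: "x \<in> carrier B \<Longrightarrow> csmult B (c + d) x = csmult B c x \<oplus> csmult B d x"
    and csmult_csmult: "x \<in> carrier B \<Longrightarrow> csmult B c (csmult B d x) = csmult B (c * d) x"
    and csmult_one: "x \<in> carrier B \<Longrightarrow> csmult B 1 x = x"
    and mult_csmult_left: "\<lbrakk>x \<in> carrier B; y \<in> carrier B\<rbrakk> \<Longrightarrow>
          csmult B c x \<otimes> y = csmult B c (x \<otimes> y)"
    and mult_csmult_right: "\<lbrakk>x \<in> carrier B; y \<in> carrier B\<rbrakk> \<Longrightarrow>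
          x \<otimes> csmult B c y = csmult B c (x \<otimes> y)"
    and cadj_closed: "x \<in> carrier B \<Longrightarrow> cadj B x \<in> carrier B"
    and cadj_add: "\<lbrakk>x \<in> carrier B; y \<in> carrier B\<rbrakk> \<Longrightarrow> cadj B (x \<oplus> y) = cadj B x \<oplus> cadj B y"
    and cadj_csmult: "x \<in> carrier B \<Longrightarrow> cadj B (csmult B c x) = csmult B (cnj c) (cadj B x)"
    and cadj_mult: "\<lbrakk>x \<in> carrier B; y \<in> carrier B\<rbrakk> \<Longrightarrow> cadj B (x \<otimes> y) = cadj B y \<otimes> cadj B x"
    and cadj_cadj: "x \<in> carrier B \<Longrightarrow> cadj B (cadj B x) = x"
    and cnorm_eq_0: "x \<in> carrier B \<Longrightarrow> cnorm B x = 0 \<longleftrightarrow> x = \<zero>"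
    and cnorm_triangle: "\<lbrakk>x \<in> carrier B; y \<in> carrier B\<rbrakk> \<Longrightarrow>
          cnorm B (x \<oplus> y) \<le> cnorm B x + cnorm B y"
    and cnorm_csmult: "x \<in> carrier B \<Longrightarrow> cnorm B (csmult B c x) = cmod c * cnorm B x"
    and cnorm_mult: "\<lbrakk>x \<in> carrier B; y \<in> carrier B\<rbrakk> \<Longrightarrow>
          cnorm B (x \<otimes> y) \<le> cnorm B x * cnorm B y"
    and cnorm_cstar: "x \<in> carrier B \<Longrightarrow> cnorm B (cadj B x \<otimes> x) = (cnorm B x)\<^sup>2"
    and cnorm_complete: "\<lbrakk>\<And>n. X n \<in> carrier B;
          \<And>e. e > 0 \<Longrightarrow> \<exists>N. \<forall>m\<ge>N. \<forall>n\<ge>N. cnorm B (X m \<ominus> X n) < e\<rbrakk> \<Longrightarrow>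
          \<exists>x\<in>carrier B. (\<lambda>n. cnorm B (X n \<ominus> x)) \<longlonglongrightarrow> 0"

definition unitary_on :: "'b cstar_ring \<Rightarrow> 'b \<Rightarrow> bool" where
  "unitary_on B u \<longleftrightarrow> u \<in> carrier B \<and>
     cadj B u \<otimes>\<^bsub>B\<^esub> u = \<one>\<^bsub>B\<^esub> \<and> u \<otimes>\<^bsub>B\<^esub> cadj B u = \<one>\<^bsub>B\<^esub>"

definition star_hom :: "('a::cstar_algebra \<Rightarrow> 'b) \<Rightarrow> 'b cstar_ring \<Rightarrow> bool" where
  "star_hom \<phi> B \<longleftrightarrow>
     (\<forall>x. \<phi> x \<in> carrier B) \<and>
     (\<forall>x y. \<phi> (x + y) = \<phi> x \<oplus>\<^bsub>B\<^esub> \<phi> y) \<and>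
     (\<forall>c x. \<phi> (c *\<^sub>C x) = csmult B c (\<phi> x)) \<and>
     (\<forall>x y. \<phi> (x * y) = \<phi> x \<otimes>\<^bsub>B\<^esub> \<phi> y) \<and>
     \<phi> 1 = \<one>\<^bsub>B\<^esub> \<and>
     (\<forall>x. \<phi> (star x) = cadj B (\<phi> x))"

section \<open>The rotation algebra\<close>

definition star_subalgebra :: "'a::cstar_algebra set \<Rightarrow> bool" where
  "star_subalgebra S \<longleftrightarrow>
     1 \<in> S \<and> (\<forall>x\<in>S. \<forall>y\<in>S. x + y \<in> S \<and> x * y \<in> S) \<and>
     (\<forall>c. \<forall>x\<in>S. c *\<^sub>C x \<in> S) \<and> (\<forall>x\<in>S. star x \<in> S)"

text \<open>
  The type \<open>'a\<close> is the universal unital \<open>C\<^sup>*\<close>-algebra generated by unitaries \<open>U\<close>, \<open>V\<close> with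
  \<open>U V = e\<^bsup>2\<pi>i\<theta>\<^esup> V U\<close>. It suffices to test the universal property on algebras \<open>B\<close> whose carrier
  is a set of elements of \<open>'a\<close>: one may replace \<open>B\<close> by its \<open>C\<^sup>*\<close>-subalgebra generated by \<open>u\<close> and
  \<open>v\<close>, which is separable, hence has at most as many elements as \<open>\<complex>\<close>, and \<open>'a\<close> contains a copy
  of \<open>\<complex>\<close>.
\<close>

definition rotation_algebra :: "real \<Rightarrow> 'a::cstar_algebra \<Rightarrow> 'a \<Rightarrow> bool" where
  "rotation_algebra \<theta> U V \<longleftrightarrow>
     unitary U \<and> unitary V \<and>
     U * V = exp (2 * pi * \<i> * \<theta>) *\<^sub>C (V * U) \<and>
     (\<forall>S. star_subalgebra S \<and> closed S \<and> U \<in> S \<and> V \<in> S \<longrightarrow> S = UNIV) \<and>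
     (\<forall>(B :: 'a cstar_ring) u v.
        cstar_algebra_on B \<and> unitary_on B u \<and> unitary_on B v \<and>
        u \<otimes>\<^bsub>B\<^esub> v = csmult B (exp (2 * pi * \<i> * \<theta>)) (v \<otimes>\<^bsub>B\<^esub> u) \<longrightarrow>
        (\<exists>!\<phi>. star_hom \<phi> B \<and> \<phi> U = u \<and> \<phi> V = v))"

section \<open>The smooth subalgebra and its derivations\<close>

text \<open>Integer powers of a unitary, whose inverse is its adjoint.\<close>

definition unitary_power :: "'a::cstar_algebra \<Rightarrow> int \<Rightarrow> 'a" where
  "unitary_power u m = (if 0 \<le> m then u ^ nat m else star u ^ nat (- m))"

definition rapidly_decreasing :: "(int \<Rightarrow> int \<Rightarrow> complex) \<Rightarrow> bool" where
  "rapidly_decreasing c \<longleftrightarrow>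
     (\<forall>k::nat. \<exists>C::real. \<forall>m n. (1 + \<bar>real_of_int m\<bar> + \<bar>real_of_int n\<bar>) ^ k * cmod (c m n) \<le> C)"

definition series_term ::
  "'a::cstar_algebra \<Rightarrow> 'a \<Rightarrow> (int \<Rightarrow> int \<Rightarrow> complex) \<Rightarrow> int \<times> int \<Rightarrow> 'a" where
  "series_term U V c = (\<lambda>(m, n). c m n *\<^sub>C (unitary_power U m * unitary_power V n))"

definition smooth :: "'a::cstar_algebra \<Rightarrow> 'a \<Rightarrow> 'a set" where
  "smooth U V = {x. \<exists>c. rapidly_decreasing c \<and> (series_term U V c has_sum x) UNIV}"

text \<open>Only meaningful on \<^const>\<open>smooth\<close>, and so are the maps defined from it.\<close>

definition coeffs :: "'a::cstar_algebra \<Rightarrow> 'a \<Rightarrow> 'a \<Rightarrow> int \<Rightarrow> int \<Rightarrow> complex" where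
  "coeffs U V x = (THE c. rapidly_decreasing c \<and> (series_term U V c has_sum x) UNIV)"

definition \<delta>\<^sub>1 :: "'a::cstar_algebra \<Rightarrow> 'a \<Rightarrow> 'a \<Rightarrow> 'a" where
  "\<delta>\<^sub>1 U V x = (2 * pi * \<i>) *\<^sub>C infsum (series_term U V (\<lambda>m n. of_int m * coeffs U V x m n)) UNIV"

definition \<delta>\<^sub>2 :: "'a::cstar_algebra \<Rightarrow> 'a \<Rightarrow> 'a \<Rightarrow> 'a" where
  "\<delta>\<^sub>2 U V x = (2 * pi * \<i>) *\<^sub>C infsum (series_term U V (\<lambda>m n. of_int n * coeffs U V x m n)) UNIV"

definition laplacian :: "'a::cstar_algebra \<Rightarrow> 'a \<Rightarrow> 'a \<Rightarrow> 'a" where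
  "laplacian U V x = \<delta>\<^sub>1 U V (\<delta>\<^sub>1 U V x) + \<delta>\<^sub>2 U V (\<delta>\<^sub>2 U V x)"

section \<open>Harmonic unitaries\<close>

definition smooth_unitaries :: "'a::cstar_algebra \<Rightarrow> 'a \<Rightarrow> 'a set" where
  "smooth_unitaries U V = {u \<in> smooth U V. unitary u}"

text \<open>The trace below is a nonnegative real number, so taking its real part loses nothing.\<close>

definition energy :: "'a::cstar_algebra \<Rightarrow> 'a \<Rightarrow> ('a \<Rightarrow> complex) \<Rightarrow> 'a \<Rightarrow> real" where
  "energy U V \<tau> u =
     1/2 * Re (\<tau> (star (\<delta>\<^sub>1 U V u) * \<delta>\<^sub>1 U V u + star (\<delta>\<^sub>2 U V u) * \<delta>\<^sub>2 U V u))"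

definition harmonic :: "'a::cstar_algebra \<Rightarrow> 'a \<Rightarrow> ('a \<Rightarrow> complex) \<Rightarrow> 'a \<Rightarrow> bool" where
  "harmonic U V \<tau> u \<longleftrightarrow>
     u \<in> smooth_unitaries U V \<and>
     (\<forall>h\<in>smooth U V. star h = h \<longrightarrow>
        ((\<lambda>t. energy U V \<tau> (u * exp ((\<i> * complex_of_real t) *\<^sub>C h))) has_real_derivative 0) (at 0))"

end

theory Submission
  imports Defs
begin

text \<open>
  Write \<open>S = \<Sum>\<^sub>j (\<delta>\<^sub>j u)\<^sup>* \<delta>\<^sub>j u\<close> and \<open>T = u\<^sup>* \<Delta>u + S\<close>. The trace annihilates every
  \<open>\<delta>\<^sub>j x\<close>, so one integration by parts gives
  \<open>d/dt E(u e\<^bsup>ith\<^esup>) = - Re (i \<tau>((\<Delta>u)\<^sup>* u h))\<close> at \<open>t = 0\<close> (\<open>energy_term_has_derivative\<close>, one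
  derivation at a time). Differentiating \<open>u\<^sup>* u = 1\<close> twice gives
  \<open>(\<Delta>u)\<^sup>* u + 2 S + u\<^sup>* \<Delta>u = 0\<close>; hence \<open>(\<Delta>u)\<^sup>* u = - T - S\<close> and \<open>T\<^sup>* = - T\<close>. Since \<open>S\<close> and \<open>h\<close> are
  self-adjoint, \<open>\<tau>(S h)\<close> is real, and the first variation is \<open>Re (i \<tau>(T h))\<close>
  (\<open>energy_has_derivative\<close>). It vanishes if \<open>T = 0\<close>. Conversely, the direction \<open>h = i T\<close> is
  self-adjoint and turns it into \<open>\<tau>(T\<^sup>* T)\<close>, and the trace is faithful on smooth elements.

  The analytic content is that \<open>u e\<^bsup>ith\<^esup>\<close> is smooth and that \<open>\<delta>\<^sub>j (u e\<^bsup>ith\<^esup>)\<close> is differentiable in \<open>t\<close>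
  for the norm. Both are read off from weighted \<open>\<ell>\<^sup>1\<close> norms of Fourier coefficients. With
  \<open>W\<^sub>p = U\<^sup>m V\<^sup>n\<close> for \<open>p = (m, n)\<close>, irrationality of \<open>\<theta>\<close> forces \<open>\<tau>(W\<^sub>p) = 0\<close> for \<open>p \<noteq> 0\<close>, so the
  coefficients of a smooth \<open>x\<close> are the numbers \<open>\<tau>(W\<^sub>p\<^sup>* x)\<close>, and \<open>x\<close> is smooth exactly when it is
  the sum of its Fourier series and all the norms \<open>N\<^sub>k x = \<Sum>\<^sub>p (1 + \<bar>m\<bar> + \<bar>n\<bar>)\<^sup>k \<bar>\<tau>(W\<^sub>p\<^sup>* x)\<bar>\<close> are finite.

  One closure principle does most of the work (\<open>smooth_infsum\<close>, \<open>wiener_norm_infsum_le\<close>,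
  \<open>D_has_sum\<close>): if \<open>\<Sum>\<^sub>i N\<^sub>k y\<^sub>i < \<infinity>\<close> for all \<open>k\<close>, then \<open>\<Sum>\<^sub>i y\<^sub>i\<close> is smooth, \<open>N\<^sub>k\<close> is countably
  subadditive on it, and derivations may be applied termwise. A product \<open>x y\<close> is such a family,
  indexed by pairs of frequencies and consisting of monomials; so \<open>N\<^sub>k\<close> is submultiplicative and
  the Leibniz rule need only be checked on monomials, where it is additivity of the degree. The
  exponential series is another such family, and \<open>N\<^sub>k (e\<^sup>x - 1 - x) \<le> (N\<^sub>k x)\<^sup>2 exp (N\<^sub>k x)\<close> is the
  second-order estimate behind the derivative in \<open>t\<close>.
\<close>

section \<open>Scalars, adjoints and unitaries\<close>

lemma scaleC_one [simp]: "1 *\<^sub>C x = (x::'a::cstar_algebra)"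
  using scaleC_of_real[of 1 x] by simp

lemma scaleC_zero_left [simp]: "0 *\<^sub>C x = (0::'a::cstar_algebra)"
  using scaleC_of_real[of 0 x] by simp

lemma scaleR_eq_scaleC: "r *\<^sub>R x = complex_of_real r *\<^sub>C (x::'a::cstar_algebra)"
  by (simp add: scaleC_of_real)

lemma bounded_linear_scaleC_right: "bounded_linear (\<lambda>x::'a::cstar_algebra. c *\<^sub>C x)"
  by (rule bounded_linear_intro[where K = "cmod c"])
    (simp_all add: scaleC_add_right norm_scaleC scaleC_scaleC scaleR_eq_scaleC mult.commute)

lemma bounded_linear_scaleC_left: "bounded_linear (\<lambda>c. c *\<^sub>C (x::'a::cstar_algebra))"
  by (rule bounded_linear_intro[where K = "norm x"])
    (simp_all add: scaleC_add_left norm_scaleC scaleC_scaleC scaleR_eq_scaleC scaleR_conv_of_real)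

lemmas scaleC_zero_right [simp] = linear_0[OF bounded_linear.linear[OF bounded_linear_scaleC_right]]
lemmas scaleC_minus_right = linear_neg[OF bounded_linear.linear[OF bounded_linear_scaleC_right]]
lemmas scaleC_diff_right = linear_diff[OF bounded_linear.linear[OF bounded_linear_scaleC_right]]
lemmas scaleC_minus_left = linear_neg[OF bounded_linear.linear[OF bounded_linear_scaleC_left]]

lemma star_one [simp]: "star 1 = (1::'a::cstar_algebra)"
  by (metis mult.left_neutral mult.right_neutral star_mult star_star)

text \<open>
  The \<open>C\<^sup>*\<close>-identity and submultiplicativity give \<open>\<parallel>x\<parallel>\<^sup>2 \<le> \<parallel>x\<^sup>*\<parallel> \<parallel>x\<parallel>\<close>; apply this to \<open>x\<close> and \<open>x\<^sup>*\<close>.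
\<close>

lemma norm_star [simp]: "norm (star x) = norm (x::'a::cstar_algebra)"
proof -
  have le: "norm y \<le> norm (star y)" for y :: 'a
  proof (cases "norm y = 0")
    case False
    have "norm y * norm y \<le> norm (star y) * norm y"
      using norm_mult_ineq[of "star y" y] by (simp add: cstar_identity power2_eq_square)
    then show ?thesis using False by simp
  qed simp
  show ?thesis using le[of x] le[of "star x"] by (simp add: star_star)
qed

lemma bounded_linear_star: "bounded_linear (star :: 'a::cstar_algebra \<Rightarrow> 'a)"
  by (rule bounded_linear_intro[where K = 1])
    (simp_all add: star_add star_scaleC scaleR_eq_scaleC)

lemmas star_diff = linear_diff[OF bounded_linear.linear[OF bounded_linear_star]]

lemma norm_unitary: "unitary u \<Longrightarrow> norm u = 1"
  using cstar_identity[of u] norm_ge_zero[of u] by (auto simp: unitary_def power2_eq_1_iff)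

lemma unitary_mult: "unitary u \<Longrightarrow> unitary v \<Longrightarrow> unitary (u * v)"
  unfolding unitary_def star_mult by (metis mult.assoc mult.right_neutral)

lemma unitary_power_plus_one:
  assumes "unitary u" shows "unitary_power u (m + 1) = unitary_power u m * u"
proof (cases "0 \<le> m")
  case True
  then show ?thesis
    by (simp add: unitary_power_def nat_add_distrib power_Suc2 del: power_Suc)
next
  case False
  then obtain k where k: "nat (- m) = Suc k" using gr0_conv_Suc[of "nat (- m)"] by auto
  then have m: "m = - int k - 1" by linarith
  have "unitary_power u m = star u ^ k * star u"
    using False k by (simp add: unitary_power_def power_Suc2 del: power_Suc)
  then have "unitary_power u m * u = star u ^ k"
    using assms by (simp add: mult.assoc unitary_def)
  then show ?thesis unfolding m by (cases "k = 0") (auto simp: unitary_power_def)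
qed

lemma unitary_power_minus_one:
  assumes "unitary u" shows "unitary_power u (m - 1) = unitary_power u m * star u"
  using assms unitary_power_plus_one[OF assms, of "m - 1"]
  by (simp add: mult.assoc unitary_def)

lemma unitary_power_add:
  assumes "unitary u" shows "unitary_power u (m + n) = unitary_power u m * unitary_power u n"
proof (induction n rule: int_induct[where k = 0])
  case base
  then show ?case by (simp add: unitary_power_def)
next
  case (step1 n)
  then show ?case
    using unitary_power_plus_one[OF assms, of "m + n"] unitary_power_plus_one[OF assms, of n]
    by (simp add: add.assoc mult.assoc)
next
  case (step2 n)
  then show ?case
    using unitary_power_minus_one[OF assms, of "m + n"] unitary_power_minus_one[OF assms, of n]
    by (simp add: add_diff_eq mult.assoc)
qed

lemma star_power: "star ((x::'a::cstar_algebra) ^ n) = star x ^ n"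
  by (induction n) (simp_all add: star_mult power_commutes)

lemma star_unitary_power: "star (unitary_power u m) = unitary_power u (- m)"
  by (simp add: unitary_power_def star_power star_star)

lemma unitary_unitary_power:
  assumes "unitary u" shows "unitary (unitary_power u m)"
  using unitary_power_add[OF assms, of m "- m"] unitary_power_add[OF assms, of "- m" m]
  by (simp add: unitary_def star_unitary_power) (simp add: unitary_power_def)

lemma scaled_commutation_unitary_power:
  fixes a u :: "'a::cstar_algebra"
  assumes u: "unitary u" and c: "c \<noteq> 0" and comm: "a * u = c *\<^sub>C (u * a)"
  shows "a * unitary_power u n = (c powi n) *\<^sub>C (unitary_power u n * a)"
proof (induction n rule: int_induct[where k = 0])
  case base
  then show ?case by (simp add: unitary_power_def)
next
  case (step1 n)
  have "a * unitary_power u (n + 1) = (a * unitary_power u n) * u"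
    by (simp add: unitary_power_plus_one[OF u] mult.assoc)
  also have "\<dots> = (c powi n) *\<^sub>C (unitary_power u n * (a * u))"
    by (simp add: step1 mult_scaleC_left mult.assoc)
  also have "\<dots> = (c powi (n + 1)) *\<^sub>C (unitary_power u (n + 1) * a)"
    using c by (simp add: comm mult_scaleC_right scaleC_scaleC power_int_add
        unitary_power_plus_one[OF u] mult.assoc)
  finally show ?case .
next
  case (step2 n)
  have "star u * (a * u) * star u = c *\<^sub>C (star u * u * (a * star u))"
    by (simp add: comm mult_scaleC_left mult_scaleC_right mult.assoc)
  moreover have "star u * (a * u) * star u = star u * a * (u * star u)"
    by (simp add: mult.assoc)
  ultimately have "star u * a = c *\<^sub>C (a * star u)"
    using u by (simp add: unitary_def)
  then have inv: "a * star u = inverse c *\<^sub>C (star u * a)"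
    using c by (simp add: scaleC_scaleC)
  have "a * unitary_power u (n - 1) = (a * unitary_power u n) * star u"
    by (simp add: unitary_power_minus_one[OF u] mult.assoc)
  also have "\<dots> = (c powi n) *\<^sub>C (unitary_power u n * (a * star u))"
    by (simp add: step2 mult_scaleC_left mult.assoc)
  also have "\<dots> = (c powi (n - 1)) *\<^sub>C (unitary_power u (n - 1) * a)"
    using c by (simp add: inv mult_scaleC_right scaleC_scaleC power_int_diff field_simps
        unitary_power_minus_one[OF u] mult.assoc)
  finally show ?case .
qed

section \<open>Tracial states\<close>

text \<open>
  Positivity at \<open>x + c\<close> makes \<open>c \<tau>(x\<^sup>*) + c\<^sup>* \<tau>(x)\<close> real for every scalar \<open>c\<close>. The values \<open>c = 1\<close>
  and \<open>c = i\<close> determine the imaginary and the real part of \<open>\<tau>(x\<^sup>*)\<close>.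
\<close>

lemma tracial_state_star:
  assumes "tracial_state \<tau>" shows "\<tau> (star x) = cnj (\<tau> (x::'a::cstar_algebra))"
proof -
  have add: "\<tau> (a + b) = \<tau> a + \<tau> b" for a b
    using assms by (simp add: tracial_state_def bounded_linear.linear linear_add)
  have scale: "\<tau> (c *\<^sub>C a) = c * \<tau> a" for c a
    using assms by (simp add: tracial_state_def)
  have real: "Im (\<tau> (star a * a)) = 0" for a
    using assms by (auto simp: tracial_state_def complex_nonneg_Reals_iff)
  have "star (x + c *\<^sub>C 1) * (x + c *\<^sub>C 1)
      = star x * x + c *\<^sub>C star x + (cnj c *\<^sub>C x + (cnj c * c) *\<^sub>C (star 1 * 1))" for c
    by (simp add: star_add star_scaleC algebra_simps mult_scaleC_left mult_scaleC_right
        scaleC_scaleC scaleC_add_right)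
  then have *: "Im (c * \<tau> (star x)) + Im (cnj c * \<tau> x) = 0" for c
    using real[of "x + c *\<^sub>C 1"] real[of x] real[of 1] by (simp add: add scale)
  from *[of 1] *[of \<i>] show ?thesis by (simp add: complex_eq_iff)
qed

section \<open>Rapid decrease as weighted summability\<close>

text \<open>
  Since \<open>1 + \<bar>m\<bar> + \<bar>n\<bar>\<close> dominates both \<open>1 + \<bar>m\<bar>\<close> and \<open>1 + \<bar>n\<bar>\<close>, the fourth power leaves
  an inverse square in each variable.
\<close>

lemma summable_on_inverse_weight:
  "(\<lambda>(m::int, n::int). 1 / (1 + \<bar>real_of_int m\<bar> + \<bar>real_of_int n\<bar>) ^ 4) summable_on UNIV"
proof -
  let ?g = "\<lambda>m::int. 1 / (1 + \<bar>real_of_int m\<bar>) ^ 2"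
  have sums: "summable (\<lambda>n. 1 / (1 + real n) ^ 2)"
    using inverse_power_summable[of 2, where 'a = real] summable_Suc_iff[of "\<lambda>n. inverse ((real n)\<^sup>2)"]
    by (simp add: field_simps)
  then have nat: "(\<lambda>n::nat. 1 / (1 + real n) ^ 2) summable_on UNIV"
    by (intro norm_summable_imp_summable_on) simp
  have "?g summable_on (int ` UNIV)" "?g summable_on ((\<lambda>n. - int n) ` UNIV)"
    using nat by (subst summable_on_reindex; force simp: inj_on_def o_def)+
  moreover have "(UNIV::int set) = int ` UNIV \<union> (\<lambda>n. - int n) ` UNIV"
    by (auto simp: image_iff) (metis int_cases2)
  ultimately have g: "?g summable_on UNIV" by (metis summable_on_union)
  have prod: "(\<lambda>(m, n). ?g m * ?g n) summable_on UNIV \<times> UNIV"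
  proof (rule summable_on_SigmaI[where g = "\<lambda>m. ?g m * infsum ?g UNIV"])
    show "((\<lambda>n. case (m, n) of (m, n) \<Rightarrow> ?g m * ?g n) has_sum ?g m * infsum ?g UNIV) UNIV" for m
      unfolding prod.case by (intro has_sum_cmult_right has_sum_infsum g)
    show "(\<lambda>m. ?g m * infsum ?g UNIV) summable_on UNIV"
      by (intro summable_on_cmult_left g)
  qed auto
  show ?thesis
  proof (rule summable_on_comparison_test[OF prod[unfolded UNIV_Times_UNIV]], clarsimp)
    fix m n :: int
    define a where "a = \<bar>real_of_int m\<bar>"
    define b where "b = \<bar>real_of_int n\<bar>"
    have "a \<ge> 0" "b \<ge> 0" by (simp_all add: a_def b_def)
    then have "(1 + a)\<^sup>2 * (1 + b)\<^sup>2 \<le> (1 + a + b) ^ 2 * (1 + a + b) ^ 2"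
      by (intro mult_mono power_mono) auto
    also have "\<dots> = (1 + a + b) ^ 4" by (simp flip: power_add)
    finally show "1 / (1 + \<bar>real_of_int m\<bar> + \<bar>real_of_int n\<bar>) ^ 4
        \<le> 1 / ((1 + \<bar>real_of_int m\<bar>)\<^sup>2 * (1 + \<bar>real_of_int n\<bar>)\<^sup>2)"
      using \<open>a \<ge> 0\<close> \<open>b \<ge> 0\<close> unfolding a_def b_def
      by (intro divide_left_mono mult_pos_pos zero_less_power) auto
  qed auto
qed

definition weight :: "int \<times> int \<Rightarrow> real" where
  "weight p = 1 + \<bar>real_of_int (fst p)\<bar> + \<bar>real_of_int (snd p)\<bar>"

lemma weight_ge_1: "1 \<le> weight p"
  by (simp add: weight_def)

lemma weight_pos [simp]: "0 < weight p" and weight_nonneg [simp]: "0 \<le> weight p"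
  using weight_ge_1[of p] by linarith+

lemma weight_uminus [simp]: "weight (- p) = weight p"
  by (simp add: weight_def)

lemma weight_zero [simp]: "weight 0 = 1"
  by (simp add: weight_def)

text \<open>
  Submultiplicativity of the weight is what makes the weighted \<open>\<ell>\<^sup>1\<close> norms below
  submultiplicative.
\<close>

lemma weight_add_le: "weight (p + q) \<le> weight p * weight q"
proof -
  define a b c d where "a = real_of_int (fst p)" "b = real_of_int (snd p)"
    "c = real_of_int (fst q)" "d = real_of_int (snd q)"
  have "weight (p + q) \<le> 1 + (\<bar>a\<bar> + \<bar>b\<bar>) + (\<bar>c\<bar> + \<bar>d\<bar>)"
    by (simp add: weight_def a_b_c_d_def)
  also have "\<dots> \<le> 1 + (\<bar>a\<bar> + \<bar>b\<bar>) + (\<bar>c\<bar> + \<bar>d\<bar>) + (\<bar>a\<bar> + \<bar>b\<bar>) * (\<bar>c\<bar> + \<bar>d\<bar>)"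
    by simp
  also have "\<dots> = weight p * weight q"
    by (simp add: weight_def a_b_c_d_def algebra_simps)
  finally show ?thesis .
qed

text \<open>
  Trades suprema for sums: four extra powers of the weight buy summability, and conversely each
  term of a summable family is bounded by the sum.
\<close>

lemma rapidly_decreasing_iff_summable:
  "rapidly_decreasing c \<longleftrightarrow>
     (\<forall>k. (\<lambda>p. weight p ^ k * cmod (case p of (m, n) \<Rightarrow> c m n)) summable_on UNIV)"
    (is "_ \<longleftrightarrow> (\<forall>k. ?f k summable_on UNIV)")
proof
  assume c: "rapidly_decreasing c"
  show "\<forall>k. ?f k summable_on UNIV"
  proof
    fix k
    obtain C where C: "\<And>m n. (1 + \<bar>real_of_int m\<bar> + \<bar>real_of_int n\<bar>) ^ (k + 4) * cmod (c m n) \<le> C"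
      using c unfolding rapidly_decreasing_def by blast
    have "(\<lambda>p. 1 / weight p ^ 4) summable_on UNIV"
      using summable_on_inverse_weight by (simp add: weight_def case_prod_beta')
    then have "(\<lambda>p. C * (1 / weight p ^ 4)) summable_on UNIV"
      by (rule summable_on_cmult_right)
    then show "?f k summable_on UNIV"
    proof (rule summable_on_comparison_test)
      fix p :: "int \<times> int"
      obtain m n where p: "p = (m, n)" by (cases p)
      have "weight p ^ k * weight p ^ 4 * cmod (c m n) \<le> C"
        using C[of m n] by (simp add: weight_def p power_add)
      moreover have "0 < weight p ^ 4" by (rule zero_less_power) simp
      ultimately show "?f k p \<le> C * (1 / weight p ^ 4)"
        by (simp add: p pos_le_divide_eq ac_simps)
    qed simp
  qed
next
  assume s: "\<forall>k. ?f k summable_on UNIV"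
  show "rapidly_decreasing c"
    unfolding rapidly_decreasing_def
  proof
    fix k
    have "?f k (m, n) \<le> infsum (?f k) UNIV" for m n
      using finite_sum_le_infsum[of "?f k" UNIV "{(m, n)}"] s by simp
    then show "\<exists>C. \<forall>m n. (1 + \<bar>real_of_int m\<bar> + \<bar>real_of_int n\<bar>) ^ k * cmod (c m n) \<le> C"
      by (auto simp: weight_def)
  qed
qed

section \<open>Fourier coefficients\<close>

text \<open>
  The scalar \<open>q\<close> plays the part of \<open>e\<^bsup>2\<pi>i\<theta>\<^esup>\<close>, and irrationality of \<open>\<theta>\<close> enters as \<open>q\<close> having
  infinite order.
\<close>

locale irrational_rotation =
  fixes U V :: "'a::cstar_algebra" and q :: complex and \<tau> :: "'a \<Rightarrow> complex"
  assumes unitary_U: "unitary U" and unitary_V: "unitary V"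
    and commutation: "U * V = q *\<^sub>C (V * U)"
    and norm_q: "cmod q = 1" and q_not_root_of_unity: "n \<noteq> 0 \<Longrightarrow> q powi n \<noteq> 1"
    and tracial_state: "tracial_state \<tau>"
begin

lemma bounded_linear_trace: "bounded_linear \<tau>"
  using tracial_state unfolding tracial_state_def by (elim conjE)

lemma trace_scaleC: "\<tau> (c *\<^sub>C x) = c * \<tau> x"
  using tracial_state unfolding tracial_state_def by (elim conjE allE)

lemma trace_one: "\<tau> 1 = 1"
  using tracial_state unfolding tracial_state_def by (elim conjE)

lemma trace_commute: "\<tau> (x * y) = \<tau> (y * x)"
  using tracial_state unfolding tracial_state_def by (elim conjE allE)

lemma trace_nonneg: "\<tau> (star x * x) \<in> \<real>\<^sub>\<ge>\<^sub>0"
  using tracial_state unfolding tracial_state_def by (elim conjE allE)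

lemmas trace_add = linear_add[OF bounded_linear.linear[OF bounded_linear_trace]]
lemmas trace_diff = linear_diff[OF bounded_linear.linear[OF bounded_linear_trace]]
lemmas trace_zero [simp] = linear_0[OF bounded_linear.linear[OF bounded_linear_trace]]
lemmas trace_minus = linear_neg[OF bounded_linear.linear[OF bounded_linear_trace]]

definition W :: "int \<times> int \<Rightarrow> 'a" where
  "W p = unitary_power U (fst p) * unitary_power V (snd p)"

lemma unitary_W: "unitary (W p)"
  unfolding W_def by (intro unitary_mult unitary_unitary_power unitary_U unitary_V)

lemma norm_W [simp]: "norm (W p) = 1"
  by (rule norm_unitary[OF unitary_W])

lemma W_zero [simp]: "W 0 = 1"
  by (simp add: W_def unitary_power_def)

lemma q_nonzero: "q \<noteq> 0"
  using norm_q by auto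

lemma commute_U_unitary_power_V:
  "U * unitary_power V n = (q powi n) *\<^sub>C (unitary_power V n * U)"
  by (rule scaled_commutation_unitary_power[OF unitary_V q_nonzero commutation])

lemma commute_unitary_powers:
  "unitary_power V n * unitary_power U m
    = (inverse (q powi n) powi m) *\<^sub>C (unitary_power U m * unitary_power V n)"
proof (rule scaled_commutation_unitary_power[OF unitary_U])
  show "unitary_power V n * U = inverse (q powi n) *\<^sub>C (U * unitary_power V n)"
    using q_nonzero by (simp add: commute_U_unitary_power_V scaleC_scaleC)
qed (simp add: q_nonzero)

text \<open>
  Multiplication of monomials adds frequencies up to a phase. Norm estimates see only the
  modulus of the phase, so its value is left implicit.
\<close>

lemma W_mult: "\<exists>\<omega>. cmod \<omega> = 1 \<and> W p * W r = \<omega> *\<^sub>C W (p + r)"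
proof -
  let ?\<omega> = "inverse (q powi (snd p)) powi (fst r)"
  have "W p * W r = unitary_power U (fst p) * (unitary_power V (snd p) * unitary_power U (fst r))
      * unitary_power V (snd r)"
    by (simp add: W_def mult.assoc)
  also have "\<dots> = ?\<omega> *\<^sub>C W (p + r)"
    by (simp add: commute_unitary_powers mult_scaleC_left mult_scaleC_right W_def mult.assoc
        unitary_power_add unitary_U unitary_V)
  finally show ?thesis
    by (metis norm_q norm_power_int norm_inverse inverse_1 power_int_1_left)
qed

lemma star_W: "\<exists>\<omega>. cmod \<omega> = 1 \<and> star (W p) = \<omega> *\<^sub>C W (- p)"
proof -
  have "star (W p) = (inverse (q powi (- snd p)) powi (- fst p)) *\<^sub>C W (- p)"
    by (simp add: W_def star_mult star_unitary_power commute_unitary_powers)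
  then show ?thesis
    by (metis norm_q norm_power_int norm_inverse inverse_1 power_int_1_left)
qed

lemma trace_conjugate:
  assumes "unitary a" and "a * x = c *\<^sub>C (x * a)" and "c \<noteq> 1"
  shows "\<tau> x = 0"
proof -
  have "\<tau> x = \<tau> (star a * (a * x))"
    using assms(1) by (simp add: unitary_def flip: mult.assoc)
  also have "\<dots> = c * \<tau> (star a * (x * a))"
    by (simp add: assms(2) mult_scaleC_right trace_scaleC)
  also have "\<tau> (star a * (x * a)) = \<tau> ((x * a) * star a)"
    by (rule trace_commute)
  also have "\<dots> = \<tau> x"
    using assms(1) by (simp add: unitary_def mult.assoc)
  finally show ?thesis using \<open>c \<noteq> 1\<close> by simp
qed

text \<open>
  Conjugation by \<open>U\<close> multiplies \<open>U\<^sup>m V\<^sup>n\<close> by \<open>q\<^sup>n\<close> and conjugation by \<open>V\<close> multiplies it by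
  \<open>q\<^bsup>-m\<^esup>\<close>; a trace is invariant under conjugation, and one of these phases differs from \<open>1\<close>.
\<close>

lemma trace_W: "\<tau> (W p) = (if p = 0 then 1 else 0)"
proof -
  have "\<tau> (W p) = 0" if "snd p \<noteq> 0"
  proof (rule trace_conjugate[OF unitary_U])
    have "U * unitary_power U m = unitary_power U m * U" for m
      using unitary_power_add[OF unitary_U, of 1 m] unitary_power_add[OF unitary_U, of m 1]
      by (simp add: unitary_power_def add.commute split: if_splits)
    then show "U * W p = (q powi snd p) *\<^sub>C (W p * U)"
      unfolding W_def
      by (metis commute_U_unitary_power_V mult.assoc mult_scaleC_right)
    show "q powi snd p \<noteq> 1" using that by (rule q_not_root_of_unity)
  qed
  moreover have "\<tau> (W p) = 0" if "fst p \<noteq> 0"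
  proof (rule trace_conjugate[OF unitary_V])
    have "V * unitary_power V m = unitary_power V m * V" for m
      using unitary_power_add[OF unitary_V, of 1 m] unitary_power_add[OF unitary_V, of m 1]
      by (simp add: unitary_power_def add.commute split: if_splits)
    moreover have "V * unitary_power U m = (inverse q powi m) *\<^sub>C (unitary_power U m * V)" for m
      using commute_unitary_powers[of 1 m] by (simp add: unitary_power_def)
    ultimately show "V * W p = (inverse q powi fst p) *\<^sub>C (W p * V)"
      unfolding W_def by (metis mult.assoc mult_scaleC_left)
    show "inverse q powi fst p \<noteq> 1"
      using q_not_root_of_unity[OF that] by (simp add: power_int_inverse)
  qed
  ultimately show ?thesis
    using prod_eqI[of p 0] by (cases "p = 0") (auto simp: trace_one)
qed

definition fourier :: "'a \<Rightarrow> int \<times> int \<Rightarrow> complex" where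
  "fourier x p = \<tau> (star (W p) * x)"

lemma bounded_linear_fourier: "bounded_linear (\<lambda>x. fourier x p)"
  unfolding fourier_def
  by (intro bounded_linear_compose[OF bounded_linear_trace] bounded_linear_mult_right)

lemma fourier_scaleC: "fourier (c *\<^sub>C x) p = c * fourier x p"
  by (simp add: fourier_def mult_scaleC_right trace_scaleC)

lemma fourier_add: "fourier (x + y) p = fourier x p + fourier y p"
  by (simp add: fourier_def algebra_simps trace_add)

lemma fourier_zero: "fourier x 0 = \<tau> x"
  by (simp add: fourier_def)

lemma fourier_W: "fourier (W r) p = (if p = r then 1 else 0)"
proof (cases "p = r")
  case True
  then show ?thesis using unitary_W[of r] by (simp add: fourier_def unitary_def trace_one)
next
  case False
  obtain \<omega> \<omega>' where "star (W p) = \<omega> *\<^sub>C W (- p)" "W (- p) * W r = \<omega>' *\<^sub>C W (- p + r)"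
    using star_W W_mult by blast
  then show ?thesis using False
    by (auto simp: fourier_def mult_scaleC_left trace_scaleC trace_W add.commute[of "- p"])
qed

text \<open>
  The monomials are orthonormal for the trace and the functional \<open>x \<mapsto> \<tau>(W\<^sub>r\<^sup>* x)\<close> is continuous,
  so it can be applied to the series term by term.
\<close>

lemma fourier_has_sum:
  assumes "((\<lambda>p. c p *\<^sub>C W p) has_sum x) UNIV"
  shows "fourier x r = c r"
proof -
  have "((\<lambda>p. fourier (c p *\<^sub>C W p) r) has_sum fourier x r) UNIV"
    by (rule has_sum_bounded_linear[OF bounded_linear_fourier assms])
  also have "(\<lambda>p. fourier (c p *\<^sub>C W p) r) = (\<lambda>p. if p = r then c r else 0)"
    by (auto simp: fourier_scaleC fourier_W)
  finally have "((\<lambda>p. if p = r then c r else 0) has_sum fourier x r) UNIV" .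
  moreover have "((\<lambda>p. if p = r then c r else 0) has_sum c r) UNIV"
    by (rule has_sum_finite_neutralI[where B = "{r}"]) auto
  ultimately show ?thesis by (rule has_sum_unique)
qed

lemma series_term_eq: "series_term U V c = (\<lambda>p. (case p of (m, n) \<Rightarrow> c m n) *\<^sub>C W p)"
  by (auto simp: series_term_def W_def)

text \<open>
  Replaces the existentially quantified coefficient sequence by the one computed with the trace,
  which is the only candidate.
\<close>

lemma smooth_iff:
  "x \<in> smooth U V \<longleftrightarrow>
     (\<forall>k. (\<lambda>p. weight p ^ k * cmod (fourier x p)) summable_on UNIV) \<and>
     ((\<lambda>p. fourier x p *\<^sub>C W p) has_sum x) UNIV" (is "_ \<longleftrightarrow> ?R")
proof
  assume "x \<in> smooth U V"
  then obtain c where c: "rapidly_decreasing c"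
    and sum: "((\<lambda>p. (case p of (m, n) \<Rightarrow> c m n) *\<^sub>C W p) has_sum x) UNIV"
    by (auto simp: smooth_def series_term_eq)
  have "(case p of (m, n) \<Rightarrow> c m n) = fourier x p" for p
    using fourier_has_sum[OF sum] by simp
  then show ?R using c sum by (simp add: rapidly_decreasing_iff_summable)
next
  assume R: ?R
  then show "x \<in> smooth U V" unfolding smooth_def
    by (auto simp: rapidly_decreasing_iff_summable series_term_eq
        intro!: exI[of _ "\<lambda>m n. fourier x (m, n)"])
qed

lemma coeffs_eq:
  assumes "x \<in> smooth U V" shows "coeffs U V x m n = fourier x (m, n)"
proof -
  have "coeffs U V x = (\<lambda>m n. fourier x (m, n))"
    unfolding coeffs_def
  proof (rule the_equality)
    show "rapidly_decreasing (\<lambda>m n. fourier x (m, n)) \<and>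
      (series_term U V (\<lambda>m n. fourier x (m, n)) has_sum x) UNIV"
      using assms by (simp add: smooth_iff rapidly_decreasing_iff_summable series_term_eq)
    fix c assume "rapidly_decreasing c \<and> (series_term U V c has_sum x) UNIV"
    then have sum: "((\<lambda>p. (case p of (m, n) \<Rightarrow> c m n) *\<^sub>C W p) has_sum x) UNIV"
      by (simp add: series_term_eq)
    have "fourier x p = (case p of (m, n) \<Rightarrow> c m n)" for p
      by (rule fourier_has_sum[OF sum])
    then show "c = (\<lambda>m n. fourier x (m, n))" by auto
  qed
  then show ?thesis by simp
qed

lemma smooth_eqI:
  assumes "x \<in> smooth U V" "y \<in> smooth U V" "\<And>p. fourier x p = fourier y p"
  shows "x = y"
proof -
  have "(\<lambda>p. fourier x p *\<^sub>C W p) = (\<lambda>p. fourier y p *\<^sub>C W p)" using assms(3) by simp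
  then show ?thesis using assms(1,2) unfolding smooth_iff by (metis has_sum_unique)
qed

text \<open>
  Bessel's inequality: positivity at \<open>x - c W\<^sub>p\<close>, with \<open>c\<close> the Fourier coefficient at \<open>p\<close>, gives
  \<open>\<bar>c\<bar>\<^sup>2 \<le> \<tau>(x\<^sup>* x)\<close>. So all coefficients vanish, and a smooth element is the sum of its series.
\<close>

lemma smooth_trace_faithful:
  assumes "x \<in> smooth U V" and "\<tau> (star x * x) = 0"
  shows "x = 0"
proof -
  have "fourier x p = 0" for p
  proof -
    define c where "c = fourier x p"
    have "star (x - c *\<^sub>C W p) * (x - c *\<^sub>C W p)
        = star x * x - c *\<^sub>C (star x * W p) - cnj c *\<^sub>C (star (W p) * x)
          + (c * cnj c) *\<^sub>C (star (W p) * W p)"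
      by (simp add: star_diff star_scaleC right_diff_distrib left_diff_distrib mult_scaleC_left
          mult_scaleC_right scaleC_scaleC scaleC_diff_right mult.commute[of c])
    moreover have "\<tau> (star x * W p) = cnj c"
      using tracial_state_star[OF tracial_state, of "star (W p) * x"]
      by (simp add: star_mult star_star c_def fourier_def)
    ultimately have "\<tau> (star (x - c *\<^sub>C W p) * (x - c *\<^sub>C W p)) = - (c * cnj c)"
      using unitary_W[of p] assms(2)
      by (simp add: trace_add trace_diff trace_scaleC unitary_def trace_one)
        (simp add: c_def fourier_def)
    then have "- (c * cnj c) \<in> \<real>\<^sub>\<ge>\<^sub>0" using trace_nonneg by metis
    then have "c = 0"
      using complex_neq_0[of c] by (auto simp: complex_nonneg_Reals_iff complex_mult_cnj)
    then show ?thesis unfolding c_def .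
  qed
  then have "((\<lambda>_::int \<times> int. 0) has_sum x) UNIV"
    using assms(1) unfolding smooth_iff by (metis (no_types, lifting) has_sum_cong scaleC_zero_left)
  then show ?thesis by (rule has_sum_unique) simp
qed

section \<open>Weighted Wiener norms\<close>

definition wiener_norm :: "nat \<Rightarrow> 'a \<Rightarrow> real" where
  "wiener_norm k x = (\<Sum>\<^sub>\<infinity>p. weight p ^ k * cmod (fourier x p))"

lemma wiener_norm_has_sum:
  "x \<in> smooth U V \<Longrightarrow>
    ((\<lambda>p. weight p ^ k * cmod (fourier x p)) has_sum wiener_norm k x) UNIV"
  by (simp add: smooth_iff wiener_norm_def)

lemma wiener_norm_nonneg [simp]: "0 \<le> wiener_norm k x"
  by (simp add: wiener_norm_def infsum_nonneg)

lemma norm_le_wiener_norm: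
  assumes "x \<in> smooth U V" shows "norm x \<le> wiener_norm 0 x"
proof (rule norm_infsum_le[OF _ wiener_norm_has_sum[OF assms]])
  show "((\<lambda>p. fourier x p *\<^sub>C W p) has_sum x) UNIV" using assms by (simp add: smooth_iff)
qed (simp add: norm_scaleC)

lemma has_sum_monomial:
  "((\<lambda>p. fourier (c *\<^sub>C W r) p *\<^sub>C W p) has_sum c *\<^sub>C W r) UNIV"
  by (rule has_sum_finite_neutralI[where B = "{r}"]) (auto simp: fourier_scaleC fourier_W)

lemma wiener_has_sum_monomial:
  "((\<lambda>p. weight p ^ k * cmod (fourier (c *\<^sub>C W r) p)) has_sum weight r ^ k * cmod c) UNIV"
  by (rule has_sum_finite_neutralI[where B = "{r}"]) (auto simp: fourier_scaleC fourier_W)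

lemma smooth_monomial: "c *\<^sub>C W r \<in> smooth U V"
  unfolding smooth_iff
  using has_sum_monomial has_sum_imp_summable[OF wiener_has_sum_monomial] by blast

lemma wiener_norm_monomial: "wiener_norm k (c *\<^sub>C W r) = weight r ^ k * cmod c"
  unfolding wiener_norm_def by (rule infsumI[OF wiener_has_sum_monomial])

text \<open>
  The hypothesis says that the double family of weighted coefficients, indexed by \<open>i\<close> and by
  the frequency \<open>p\<close>, is absolutely summable. Summing it over \<open>i\<close> first gives the coefficients of the
  limit with their bound; the unweighted family of monomials, summed in both orders, shows
  that the limit is the sum of its own Fourier series.
\<close>

lemma
  fixes y :: "'i \<Rightarrow> 'a"
  assumes y: "\<And>i. y i \<in> smooth U V"
    and sum: "\<And>k. (\<lambda>i. wiener_norm k (y i)) summable_on UNIV"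
  shows has_sum_infsum_wiener: "(y has_sum infsum y UNIV) UNIV"
    and smooth_infsum: "infsum y UNIV \<in> smooth U V"
    and wiener_norm_infsum_le: "wiener_norm k (infsum y UNIV) \<le> (\<Sum>\<^sub>\<infinity>i. wiener_norm k (y i))"
proof -
  \<comment> \<open>Convergence in the algebra itself: \<open>N\<^sub>0\<close> dominates the norm.\<close>
  have "(\<lambda>i. norm (y i)) summable_on UNIV"
    by (rule summable_on_comparison_test[OF sum[of 0]]) (auto intro: norm_le_wiener_norm y)
  then show s: "(y has_sum infsum y UNIV) UNIV"
    by (rule has_sum_infsum[OF abs_summable_summable])
  let ?s = "infsum y UNIV"
  let ?f = "\<lambda>k (i, p). weight p ^ k * cmod (fourier (y i) p)"
  have f: "(?f k has_sum (\<Sum>\<^sub>\<infinity>i. wiener_norm k (y i))) (UNIV \<times> UNIV)" for k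
  proof -
    have *: "((\<lambda>p. ?f k (i, p)) has_sum wiener_norm k (y i)) UNIV" for i
      using wiener_norm_has_sum[OF y] by simp
    then have "?f k summable_on (UNIV \<times> UNIV)"
      by (rule summable_on_SigmaI) (use sum in auto)
    with * sum show ?thesis by (intro has_sum_SigmaI) auto
  qed
  have four: "((\<lambda>i. fourier (y i) p) has_sum fourier ?s p) UNIV" for p
    by (rule has_sum_bounded_linear[OF bounded_linear_fourier s])
  define g where "g k p = (\<Sum>\<^sub>\<infinity>i. ?f k (i, p))" for k p
  have f': "((\<lambda>(p, i). ?f k (i, p)) has_sum (\<Sum>\<^sub>\<infinity>i. wiener_norm k (y i))) (UNIV \<times> UNIV)" for k
    using f[of k] has_sum_swap[of "?f k"] by (simp add: case_prod_beta' del: UNIV_Times_UNIV)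
  have g_inner: "((\<lambda>i. ?f k (i, p)) has_sum g k p) UNIV" for k p
    unfolding g_def
    by (rule has_sum_infsum, rule summable_on_SigmaD1[where f = "\<lambda>p i. ?f k (i, p)" and A = UNIV
          and B = "\<lambda>_. UNIV"], rule has_sum_imp_summable[OF f']) simp
  have g: "(g k has_sum (\<Sum>\<^sub>\<infinity>i. wiener_norm k (y i))) UNIV" for k
    by (rule has_sum_SigmaD[OF f']) (use g_inner in simp)
  have le: "weight p ^ k * cmod (fourier ?s p) \<le> g k p" for k p
  proof -
    have "((\<lambda>i. weight p ^ k *\<^sub>R fourier (y i) p) has_sum weight p ^ k *\<^sub>R fourier ?s p) UNIV"
      by (rule has_sum_bounded_linear[OF bounded_linear_scaleR_right four])
    from norm_infsum_le[OF this g_inner[of k p]] show ?thesis by simp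
  qed
  have rapid: "(\<lambda>p. weight p ^ k * cmod (fourier ?s p)) summable_on UNIV" for k
    by (rule summable_on_comparison_test[OF has_sum_imp_summable[OF g[of k]] le]) simp
  show "wiener_norm k ?s \<le> (\<Sum>\<^sub>\<infinity>i. wiener_norm k (y i))"
    unfolding wiener_norm_def[of k ?s] by (rule has_sum_mono[OF has_sum_infsum[OF rapid] g le])
  let ?h = "\<lambda>(i, p). fourier (y i) p *\<^sub>C W p"
  have "(\<lambda>z. norm (?h z)) summable_on (UNIV \<times> UNIV)"
    using has_sum_imp_summable[OF f[of 0]] by (simp add: case_prod_beta' norm_scaleC)
  then have "?h summable_on (UNIV \<times> UNIV)" by (rule abs_summable_summable)
  then have "(?h has_sum ?s) (UNIV \<times> UNIV)"
    using y s by (intro has_sum_SigmaI[where g = y]) (auto simp: smooth_iff)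
  then have "((\<lambda>(p, i). ?h (i, p)) has_sum ?s) (UNIV \<times> UNIV)"
    using has_sum_swap[of ?h] by (simp add: case_prod_beta' del: UNIV_Times_UNIV)
  then have "((\<lambda>p. fourier ?s p *\<^sub>C W p) has_sum ?s) UNIV"
    by (rule has_sum_SigmaD)
      (use has_sum_bounded_linear[OF bounded_linear_scaleC_left four] in simp)
  with rapid show "?s \<in> smooth U V" by (simp add: smooth_iff)
qed


section \<open>Products, adjoints and exponentials of smooth elements\<close>

lemma smooth_zero: "0 \<in> smooth U V"
  using smooth_monomial[of 0 0] by simp

lemma smooth_one: "1 \<in> smooth U V"
  using smooth_monomial[of 1 0] by simp

lemma wiener_norm_one: "wiener_norm k 1 = 1"
  using wiener_norm_monomial[of k 1 0] by simp

lemma smooth_scaleC: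
  assumes "x \<in> smooth U V" shows "c *\<^sub>C x \<in> smooth U V"
  unfolding smooth_iff
proof
  show "\<forall>k. (\<lambda>p. weight p ^ k * cmod (fourier (c *\<^sub>C x) p)) summable_on UNIV"
  proof
    fix k
    have "(\<lambda>p. cmod c * (weight p ^ k * cmod (fourier x p))) summable_on UNIV"
      using assms by (intro summable_on_cmult_right) (simp add: smooth_iff)
    then show "(\<lambda>p. weight p ^ k * cmod (fourier (c *\<^sub>C x) p)) summable_on UNIV"
      by (simp add: fourier_scaleC norm_mult ac_simps)
  qed
  have "((\<lambda>p. c *\<^sub>C (fourier x p *\<^sub>C W p)) has_sum c *\<^sub>C x) UNIV"
    using assms by (intro has_sum_bounded_linear[OF bounded_linear_scaleC_right]) (simp add: smooth_iff)
  then show "((\<lambda>p. fourier (c *\<^sub>C x) p *\<^sub>C W p) has_sum c *\<^sub>C x) UNIV"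
    by (simp add: fourier_scaleC scaleC_scaleC)
qed

lemma wiener_norm_scaleC: "wiener_norm k (c *\<^sub>C x) = cmod c * wiener_norm k x"
  unfolding wiener_norm_def
  by (subst infsum_cmult_right'[symmetric]) (simp add: fourier_scaleC norm_mult ac_simps)

lemma smooth_add:
  assumes "x \<in> smooth U V" "y \<in> smooth U V" shows "x + y \<in> smooth U V"
  unfolding smooth_iff
proof
  show "\<forall>k. (\<lambda>p. weight p ^ k * cmod (fourier (x + y) p)) summable_on UNIV"
  proof
    fix k
    have "(\<lambda>p. weight p ^ k * cmod (fourier x p) + weight p ^ k * cmod (fourier y p)) summable_on UNIV"
      using assms by (intro summable_on_add) (simp_all add: smooth_iff)
    then show "(\<lambda>p. weight p ^ k * cmod (fourier (x + y) p)) summable_on UNIV"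
      by (rule summable_on_comparison_test)
        (simp_all add: fourier_add norm_triangle_ineq flip: distrib_left)
  qed
  have "((\<lambda>p. fourier x p *\<^sub>C W p + fourier y p *\<^sub>C W p) has_sum x + y) UNIV"
    using assms by (intro has_sum_add) (simp_all add: smooth_iff)
  then show "((\<lambda>p. fourier (x + y) p *\<^sub>C W p) has_sum x + y) UNIV"
    by (simp add: fourier_add scaleC_add_left)
qed

lemma monomial_mult:
  "\<exists>e. cmod e = cmod c * cmod d \<and> (c *\<^sub>C W p) * (d *\<^sub>C W r) = e *\<^sub>C W (p + r)"
proof -
  obtain \<omega> where "cmod \<omega> = 1" "W p * W r = \<omega> *\<^sub>C W (p + r)" using W_mult by blast
  then show ?thesis
    by (intro exI[of _ "d * c * \<omega>"])
      (simp add: mult_scaleC_left mult_scaleC_right scaleC_scaleC norm_mult mult.assoc)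
qed

lemma monomial_star: "\<exists>e. cmod e = cmod c \<and> star (c *\<^sub>C W p) = e *\<^sub>C W (- p)"
proof -
  obtain \<omega> where "cmod \<omega> = 1" "star (W p) = \<omega> *\<^sub>C W (- p)" using star_W by blast
  then show ?thesis
    by (intro exI[of _ "cnj c * \<omega>"]) (simp add: star_scaleC scaleC_scaleC norm_mult)
qed

lemma wiener_norm_product_has_sum:
  assumes "x \<in> smooth U V" "y \<in> smooth U V"
  shows "((\<lambda>(p, r). (weight p ^ k * cmod (fourier x p)) * (weight r ^ k * cmod (fourier y r)))
    has_sum wiener_norm k x * wiener_norm k y) (UNIV \<times> UNIV)" (is "(?f has_sum _) _")
proof -
  have inner: "((\<lambda>r. ?f (p, r)) has_sum (weight p ^ k * cmod (fourier x p)) * wiener_norm k y) UNIV" for p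
    unfolding prod.case by (rule has_sum_cmult_right[OF wiener_norm_has_sum[OF assms(2)]])
  have outer: "((\<lambda>p. (weight p ^ k * cmod (fourier x p)) * wiener_norm k y)
      has_sum wiener_norm k x * wiener_norm k y) UNIV"
    by (rule has_sum_cmult_left[OF wiener_norm_has_sum[OF assms(1)]])
  have "?f summable_on (UNIV \<times> UNIV)"
    by (rule summable_on_SigmaI[OF inner has_sum_imp_summable[OF outer]]) auto
  with inner outer show ?thesis by (rule has_sum_SigmaI)
qed

lemma mult_terms_has_sum:
  assumes "x \<in> smooth U V" "y \<in> smooth U V"
  shows "((\<lambda>(p, r). (fourier x p *\<^sub>C W p) * (fourier y r *\<^sub>C W r)) has_sum x * y) UNIV"
    (is "(?f has_sum _) _")
proof -
  have inner: "((\<lambda>r. ?f (p, r)) has_sum (fourier x p *\<^sub>C W p) * y) UNIV" for p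
    unfolding prod.case using assms(2)
    by (intro has_sum_bounded_linear[OF bounded_linear_mult_right]) (simp add: smooth_iff)
  have outer: "((\<lambda>p. (fourier x p *\<^sub>C W p) * y) has_sum x * y) UNIV"
    using assms(1)
    by (intro has_sum_bounded_linear[OF bounded_linear_mult_left]) (simp add: smooth_iff)
  have "(\<lambda>z. norm (?f z)) summable_on (UNIV \<times> UNIV)"
  proof (rule summable_on_comparison_test)
    show "(\<lambda>(p, r). (weight p ^ 0 * cmod (fourier x p)) * (weight r ^ 0 * cmod (fourier y r)))
      summable_on (UNIV \<times> UNIV)"
      by (rule has_sum_imp_summable[OF wiener_norm_product_has_sum[OF assms]])
    fix z :: "(int \<times> int) \<times> int \<times> int"
    obtain p r where z: "z = (p, r)" by (cases z)
    show "norm (?f z) \<le> (case z of (p, r) \<Rightarrow>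
        (weight p ^ 0 * cmod (fourier x p)) * (weight r ^ 0 * cmod (fourier y r)))"
      using monomial_mult[of "fourier x p" "fourier y r" p r] by (auto simp: z norm_scaleC)
  qed simp
  then have "?f summable_on (UNIV \<times> UNIV)" by (rule abs_summable_summable)
  from has_sum_SigmaI[OF inner outer this] show ?thesis by simp
qed

text \<open>
  The product is kept as a family of monomials indexed by pairs of frequencies, rather than
  regrouped into a twisted convolution: the closure principle needs only the norms of the terms,
  and those are controlled by submultiplicativity of the weight. The last two facts let
  derivations be applied termwise to this family.
\<close>

lemma
  assumes x: "x \<in> smooth U V" and y: "y \<in> smooth U V"
  shows smooth_mult: "x * y \<in> smooth U V"
    and wiener_norm_mult: "wiener_norm k (x * y) \<le> wiener_norm k x * wiener_norm k y"
    and mult_terms_smooth: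
      "(case z of (p, r) \<Rightarrow> (fourier x p *\<^sub>C W p) * (fourier y r *\<^sub>C W r)) \<in> smooth U V"
    and mult_terms_summable: "(\<lambda>z. wiener_norm k (case z of (p, r) \<Rightarrow>
      (fourier x p *\<^sub>C W p) * (fourier y r *\<^sub>C W r))) summable_on UNIV"
proof -
  let ?f = "\<lambda>(p, r). (fourier x p *\<^sub>C W p) * (fourier y r *\<^sub>C W r)"
  let ?g = "\<lambda>k (p, r). (weight p ^ k * cmod (fourier x p)) * (weight r ^ k * cmod (fourier y r))"
  have g: "(?g k has_sum wiener_norm k x * wiener_norm k y) UNIV" for k
    using wiener_norm_product_has_sum[OF x y, of k] by simp
  show sm: "?f z \<in> smooth U V" for z
  proof -
    obtain p r where z: "z = (p, r)" by (cases z)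
    obtain e where "?f z = e *\<^sub>C W (p + r)"
      using monomial_mult[of "fourier x p" "fourier y r" p r] by (auto simp: z)
    then show ?thesis by (simp only: smooth_monomial)
  qed
  have le: "wiener_norm k (?f z) \<le> ?g k z" for k z
  proof -
    obtain p r where z: "z = (p, r)" by (cases z)
    obtain e where e: "cmod e = cmod (fourier x p) * cmod (fourier y r)"
      "?f z = e *\<^sub>C W (p + r)"
      using monomial_mult[of "fourier x p" "fourier y r" p r] by (auto simp: z)
    have "weight (p + r) ^ k \<le> (weight p * weight r) ^ k"
      by (intro power_mono weight_add_le) simp
    then have "weight (p + r) ^ k * cmod e \<le> (weight p * weight r) ^ k * cmod e"
      by (rule mult_right_mono) simp
    then show ?thesis
      unfolding e(2) wiener_norm_monomial by (simp add: z e(1) power_mult_distrib ac_simps)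
  qed
  show sum: "(\<lambda>z. wiener_norm k (?f z)) summable_on UNIV" for k
    by (rule summable_on_comparison_test[OF has_sum_imp_summable[OF g] le]) simp
  have eq: "infsum ?f UNIV = x * y" by (rule infsumI[OF mult_terms_has_sum[OF x y]])
  show "x * y \<in> smooth U V" using smooth_infsum[of ?f, OF sm sum] unfolding eq .
  have "wiener_norm k (x * y) \<le> (\<Sum>\<^sub>\<infinity>z. wiener_norm k (?f z))"
    using wiener_norm_infsum_le[of ?f, OF sm sum] unfolding eq .
  also have "\<dots> \<le> wiener_norm k x * wiener_norm k y"
    by (rule has_sum_mono[OF has_sum_infsum[OF sum] g le])
  finally show "wiener_norm k (x * y) \<le> wiener_norm k x * wiener_norm k y" .
qed

lemma smooth_power: "x \<in> smooth U V \<Longrightarrow> x ^ n \<in> smooth U V"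
  by (induction n) (simp_all add: smooth_one smooth_mult)

lemma wiener_norm_power:
  assumes "x \<in> smooth U V" shows "wiener_norm k (x ^ n) \<le> wiener_norm k x ^ n"
proof (induction n)
  case (Suc n)
  have "wiener_norm k (x * x ^ n) \<le> wiener_norm k x * wiener_norm k (x ^ n)"
    by (intro wiener_norm_mult assms smooth_power)
  also have "\<dots> \<le> wiener_norm k x * wiener_norm k x ^ n"
    by (intro mult_left_mono Suc.IH) simp
  finally show ?case by simp
qed (simp add: wiener_norm_one)

lemma star_terms_has_sum:
  assumes "x \<in> smooth U V"
  shows "((\<lambda>p. star (fourier x p *\<^sub>C W p)) has_sum star x) UNIV"
  using assms by (intro has_sum_bounded_linear[OF bounded_linear_star]) (simp add: smooth_iff)

lemma
  assumes x: "x \<in> smooth U V"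
  shows smooth_star: "star x \<in> smooth U V"
    and star_terms_smooth: "star (fourier x p *\<^sub>C W p) \<in> smooth U V"
    and star_terms_summable: "(\<lambda>p. wiener_norm k (star (fourier x p *\<^sub>C W p))) summable_on UNIV"
proof -
  show sm: "star (fourier x p *\<^sub>C W p) \<in> smooth U V" for p
    using monomial_star smooth_monomial by metis
  have "wiener_norm k (star (fourier x p *\<^sub>C W p)) = weight p ^ k * cmod (fourier x p)" for k p
    using monomial_star[of "fourier x p" p] by (auto simp: wiener_norm_monomial)
  then show sum: "(\<lambda>p. wiener_norm k (star (fourier x p *\<^sub>C W p))) summable_on UNIV" for k
    using x by (simp add: smooth_iff)
  show "star x \<in> smooth U V"
    using smooth_infsum[OF sm sum] infsumI[OF star_terms_has_sum[OF x]] by simp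
qed

text \<open>
  From the third term on, the exponential series is a family to which the closure principle
  applies, since \<open>N\<^sub>k (x\<^bsup>n+2\<^esup>) / (n+2)! \<le> (N\<^sub>k x)\<^sup>2 (N\<^sub>k x)\<^sup>n / n!\<close>.
\<close>

lemma
  assumes x: "x \<in> smooth U V"
  shows smooth_exp_remainder: "exp x - 1 - x \<in> smooth U V"
    and wiener_norm_exp_remainder:
      "wiener_norm k (exp x - 1 - x) \<le> (wiener_norm k x)\<^sup>2 * exp (wiener_norm k x)"
proof -
  let ?y = "\<lambda>n. inverse (fact (n + 2)) *\<^sub>R x ^ (n + 2)"
  let ?N = "\<lambda>k. wiener_norm k x"
  have sm: "?y n \<in> smooth U V" for n
    unfolding scaleR_eq_scaleC by (intro smooth_scaleC smooth_power x)
  have exp: "((\<lambda>n. ?N k ^ n /\<^sub>R fact n) has_sum exp (?N k)) UNIV" for k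
    using summable_norm_exp[of "?N k"] exp_converges[of "?N k"] by (rule norm_summable_imp_has_sum)
  have g: "((\<lambda>n. (?N k)\<^sup>2 * (?N k ^ n /\<^sub>R fact n)) has_sum (?N k)\<^sup>2 * exp (?N k)) UNIV" for k
    by (rule has_sum_cmult_right[OF exp])
  have le: "wiener_norm k (?y n) \<le> (?N k)\<^sup>2 * (?N k ^ n /\<^sub>R fact n)" for k n
  proof -
    have "wiener_norm k (?y n) = inverse (fact (n + 2)) * wiener_norm k (x ^ (n + 2))"
      unfolding scaleR_eq_scaleC by (simp add: wiener_norm_scaleC norm_inverse del: fact_Suc power_Suc of_real_inverse)
    also have "\<dots> \<le> inverse (fact n) * ?N k ^ (n + 2)"
      by (intro mult_mono wiener_norm_power x le_imp_inverse_le fact_mono) (auto simp del: fact_Suc)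
    finally show ?thesis by (simp add: power_add power2_eq_square ac_simps)
  qed
  have sum: "(\<lambda>n. wiener_norm k (?y n)) summable_on UNIV" for k
    by (rule summable_on_comparison_test[OF has_sum_imp_summable[OF g] le]) simp
  have "?y sums infsum ?y UNIV"
    by (rule has_sum_imp_sums[OF has_sum_infsum_wiener[OF sm sum]])
  then have eq: "infsum ?y UNIV = exp x - 1 - x"
    using exp_first_two_terms[of x] sums_unique by fastforce
  show "exp x - 1 - x \<in> smooth U V" using smooth_infsum[OF sm sum] unfolding eq .
  have "wiener_norm k (exp x - 1 - x) \<le> (\<Sum>\<^sub>\<infinity>n. wiener_norm k (?y n))"
    using wiener_norm_infsum_le[OF sm sum] unfolding eq .
  also have "\<dots> \<le> (?N k)\<^sup>2 * exp (?N k)"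
    by (rule has_sum_mono[OF has_sum_infsum[OF sum] g le])
  finally show "wiener_norm k (exp x - 1 - x) \<le> (?N k)\<^sup>2 * exp (?N k)" .
qed

end

section \<open>The derivations\<close>

text \<open>
  Both derivations of the smooth algebra are instances of one construction: an additive integer
  degree on frequencies, of at most linear growth, gives the derivation that multiplies \<open>W\<^sub>p\<close> by
  \<open>2\<pi>i\<close> times the degree of \<open>p\<close>.
\<close>

locale rotation_derivation = irrational_rotation U V q \<tau>
  for U V :: "'a::cstar_algebra" and q \<tau> +
  fixes deg :: "int \<times> int \<Rightarrow> int"
  assumes degree_add: "deg (p + r) = deg p + deg r"
    and degree_le_weight: "\<bar>real_of_int (deg p)\<bar> \<le> weight p"
begin

lemma degree_zero [simp]: "deg 0 = 0"
  using degree_add[of 0 0] by simp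

lemma degree_uminus: "deg (- p) = - deg p"
  using degree_add[of p "- p"] by simp

definition D :: "'a \<Rightarrow> 'a" where
  "D x = (2 * pi * \<i>) *\<^sub>C (\<Sum>\<^sub>\<infinity>p. (of_int (deg p) * fourier x p) *\<^sub>C W p)"

lemma
  assumes x: "x \<in> smooth U V"
  shows smooth_D: "D x \<in> smooth U V"
    and fourier_D: "fourier (D x) p = 2 * pi * \<i> * of_int (deg p) * fourier x p"
    and wiener_norm_D: "wiener_norm k (D x) \<le> 2 * pi * wiener_norm (Suc k) x"
proof -
  let ?y = "\<lambda>p. (of_int (deg p) * fourier x p) *\<^sub>C W p"
  have le: "wiener_norm k (?y p) \<le> weight p ^ Suc k * cmod (fourier x p)" for k p
    using mult_mono[OF degree_le_weight[of p] order_refl, of "weight p ^ k * cmod (fourier x p)"]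
    by (simp add: wiener_norm_monomial norm_mult ac_simps)
  have g: "((\<lambda>p. weight p ^ Suc k * cmod (fourier x p)) has_sum wiener_norm (Suc k) x) UNIV" for k
    by (rule wiener_norm_has_sum[OF x])
  have sum: "(\<lambda>p. wiener_norm k (?y p)) summable_on UNIV" for k
    by (rule summable_on_comparison_test[OF has_sum_imp_summable[OF g] le]) simp
  let ?s = "infsum ?y UNIV"
  have D: "D x = (2 * pi * \<i>) *\<^sub>C ?s" by (simp only: D_def)
  show "D x \<in> smooth U V"
    unfolding D by (intro smooth_scaleC smooth_infsum[OF smooth_monomial sum])
  have "fourier ?s p = of_int (deg p) * fourier x p"
    by (rule fourier_has_sum[OF has_sum_infsum_wiener[OF smooth_monomial sum]])
  then show "fourier (D x) p = 2 * pi * \<i> * of_int (deg p) * fourier x p"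
    unfolding D by (simp add: fourier_scaleC)
  have "wiener_norm k ?s \<le> (\<Sum>\<^sub>\<infinity>p. wiener_norm k (?y p))"
    by (rule wiener_norm_infsum_le[OF smooth_monomial sum])
  also have "\<dots> \<le> wiener_norm (Suc k) x"
    by (rule has_sum_mono[OF has_sum_infsum[OF sum] g le])
  finally show "wiener_norm k (D x) \<le> 2 * pi * wiener_norm (Suc k) x"
    unfolding D wiener_norm_scaleC by (simp add: norm_mult)
qed

lemma D_eqI:
  assumes "x \<in> smooth U V" "y \<in> smooth U V"
    and "\<And>p. fourier y p = 2 * pi * \<i> * of_int (deg p) * fourier x p"
  shows "D x = y"
  using assms by (intro smooth_eqI smooth_D) (simp_all add: fourier_D)

lemma D_add: "x \<in> smooth U V \<Longrightarrow> y \<in> smooth U V \<Longrightarrow> D (x + y) = D x + D y"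
  by (intro D_eqI smooth_add smooth_D) (simp_all add: fourier_add fourier_D distrib_left)

lemma D_scaleC: "x \<in> smooth U V \<Longrightarrow> D (c *\<^sub>C x) = c *\<^sub>C D x"
  by (intro D_eqI smooth_scaleC smooth_D) (simp_all add: fourier_scaleC fourier_D)

lemma D_monomial: "D (c *\<^sub>C W r) = (2 * pi * \<i> * of_int (deg r)) *\<^sub>C c *\<^sub>C W r"
  by (intro D_eqI smooth_scaleC smooth_monomial) (simp add: fourier_scaleC fourier_W)

lemma D_one: "D 1 = 0"
  using D_monomial[of 1 0] by simp

lemma trace_D: "x \<in> smooth U V \<Longrightarrow> \<tau> (D x) = 0"
  using fourier_D[of x 0] by (simp add: fourier_zero)

text \<open>
  A derivation is closed: the sum of the \<open>D (y i)\<close> exists because \<open>D\<close> costs one power of the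
  weight, and it has the Fourier coefficients that \<open>D s\<close> must have.
\<close>

lemma D_has_sum:
  fixes y :: "'i \<Rightarrow> 'a"
  assumes y: "\<And>i. y i \<in> smooth U V"
    and sum: "\<And>k. (\<lambda>i. wiener_norm k (y i)) summable_on UNIV"
    and s: "(y has_sum s) UNIV"
  shows "((\<lambda>i. D (y i)) has_sum D s) UNIV"
proof -
  have s_smooth: "s \<in> smooth U V"
    using smooth_infsum[OF y sum] infsumI[OF s] by simp
  have sum': "(\<lambda>i. wiener_norm k (D (y i))) summable_on UNIV" for k
    by (rule summable_on_comparison_test[OF summable_on_cmult_right[OF sum] wiener_norm_D[OF y]])
      simp
  note Dy = has_sum_infsum_wiener[OF smooth_D[OF y] sum']
  have "D s = infsum (\<lambda>i. D (y i)) UNIV"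
  proof (rule D_eqI[OF s_smooth smooth_infsum[OF smooth_D[OF y] sum']])
    fix p
    let ?c = "2 * pi * \<i> * of_int (deg p)"
    have "((\<lambda>i. ?c * fourier (y i) p) has_sum fourier (infsum (\<lambda>i. D (y i)) UNIV) p) UNIV"
      using has_sum_bounded_linear[OF bounded_linear_fourier Dy] by (simp add: fourier_D y)
    moreover have "((\<lambda>i. ?c * fourier (y i) p) has_sum ?c * fourier s p) UNIV"
      by (intro has_sum_cmult_right has_sum_bounded_linear[OF bounded_linear_fourier s])
    ultimately show "fourier (infsum (\<lambda>i. D (y i)) UNIV) p = ?c * fourier s p"
      by (rule has_sum_unique)
  qed
  with Dy show ?thesis by simp
qed

text \<open>
  On monomials the Leibniz rule is additivity of the degree; the general case follows by
  applying \<open>D\<close> termwise to the product family.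
\<close>

lemma D_mult:
  assumes x: "x \<in> smooth U V" and y: "y \<in> smooth U V"
  shows "D (x * y) = D x * y + x * D y"
proof -
  let ?X = "\<lambda>p. fourier x p *\<^sub>C W p" and ?Y = "\<lambda>r. fourier y r *\<^sub>C W r"
  let ?X' = "\<lambda>p. fourier (D x) p *\<^sub>C W p" and ?Y' = "\<lambda>r. fourier (D y) r *\<^sub>C W r"
  have terms: "D (?X p * ?Y r) = ?X' p * ?Y r + ?X p * ?Y' r" for p r
  proof -
    obtain e where e: "?X p * ?Y r = e *\<^sub>C W (p + r)" using monomial_mult by metis
    have "?X' p * ?Y r + ?X p * ?Y' r
        = (2 * pi * \<i> * of_int (deg p)) *\<^sub>C (?X p * ?Y r) + (2 * pi * \<i> * of_int (deg r)) *\<^sub>C (?X p * ?Y r)"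
      by (simp add: fourier_D x y mult_scaleC_left mult_scaleC_right scaleC_scaleC ac_simps)
    also have "\<dots> = (2 * pi * \<i> * of_int (deg (p + r))) *\<^sub>C (?X p * ?Y r)"
      by (simp add: degree_add distrib_left flip: scaleC_add_left)
    also have "\<dots> = D (?X p * ?Y r)" by (simp only: e D_monomial)
    finally show ?thesis by simp
  qed
  have "((\<lambda>z. D (case z of (p, r) \<Rightarrow> ?X p * ?Y r)) has_sum D (x * y)) UNIV"
    by (rule D_has_sum[OF mult_terms_smooth[OF x y] mult_terms_summable[OF x y]
        mult_terms_has_sum[OF x y]])
  also have "(\<lambda>z. D (case z of (p, r) \<Rightarrow> ?X p * ?Y r))
      = (\<lambda>z. (case z of (p, r) \<Rightarrow> ?X' p * ?Y r) + (case z of (p, r) \<Rightarrow> ?X p * ?Y' r))"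
    using terms by auto
  finally have "((\<lambda>z. (case z of (p, r) \<Rightarrow> ?X' p * ?Y r) + (case z of (p, r) \<Rightarrow> ?X p * ?Y' r))
      has_sum D (x * y)) UNIV" .
  moreover have "((\<lambda>z. (case z of (p, r) \<Rightarrow> ?X' p * ?Y r) + (case z of (p, r) \<Rightarrow> ?X p * ?Y' r))
      has_sum D x * y + x * D y) UNIV"
    by (intro has_sum_add mult_terms_has_sum smooth_D x y)
  ultimately show ?thesis by (rule has_sum_unique)
qed

text \<open>
  Adjoints negate frequencies, hence degrees, and complex conjugation negates \<open>i\<close>; the two
  signs cancel.
\<close>

lemma D_star:
  assumes x: "x \<in> smooth U V"
  shows "D (star x) = star (D x)"
proof -
  have terms: "D (star (fourier x p *\<^sub>C W p)) = star (fourier (D x) p *\<^sub>C W p)" for p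
  proof -
    obtain e where e: "star (fourier x p *\<^sub>C W p) = e *\<^sub>C W (- p)" using monomial_star by metis
    have "star (fourier (D x) p *\<^sub>C W p)
        = (2 * pi * \<i> * of_int (deg (- p))) *\<^sub>C star (fourier x p *\<^sub>C W p)"
      by (simp add: fourier_D x star_scaleC scaleC_scaleC degree_uminus)
    then show ?thesis by (simp only: e D_monomial)
  qed
  have "((\<lambda>p. D (star (fourier x p *\<^sub>C W p))) has_sum D (star x)) UNIV"
    by (rule D_has_sum[OF star_terms_smooth[OF x] star_terms_summable[OF x]
        star_terms_has_sum[OF x]])
  then show ?thesis
    unfolding terms using star_terms_has_sum[OF smooth_D[OF x]] by (rule has_sum_unique)
qed

section \<open>The first variation of the energy\<close>

text \<open>
  The curve is affine in \<open>t\<close> up to \<open>D (u r\<^sub>t)\<close>, where \<open>r\<^sub>t\<close> is the second-order exponential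
  remainder of \<open>i t h\<close>; the norm of this error is at most \<open>2\<pi> N\<^sub>1 (u r\<^sub>t) = O(t\<^sup>2)\<close>.
\<close>

lemma D_exp_has_vector_derivative:
  assumes u: "u \<in> smooth U V" and h: "h \<in> smooth U V"
  shows "((\<lambda>t. D (u * exp ((\<i> * complex_of_real t) *\<^sub>C h)))
    has_vector_derivative D (u * (\<i> *\<^sub>C h))) (at 0)"
proof -
  define r where "r t = exp ((\<i> * complex_of_real t) *\<^sub>C h) - 1 - (\<i> * complex_of_real t) *\<^sub>C h" for t
  let ?N = "wiener_norm 1 h"
  \<comment> \<open>For \<open>\<bar>t\<bar> \<le> 1\<close> the factor \<open>exp (\<bar>t\<bar> N\<^sub>1 h)\<close> of the remainder estimate is at most \<open>exp (N\<^sub>1 h)\<close>.\<close>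
  define K where "K = 2 * pi * wiener_norm 1 u * (?N\<^sup>2 * exp ?N)"
  have r: "r t \<in> smooth U V" for t
    unfolding r_def by (intro smooth_exp_remainder smooth_scaleC h)
  have expand: "D (u * exp ((\<i> * complex_of_real t) *\<^sub>C h))
      = D u + t *\<^sub>R D (u * (\<i> *\<^sub>C h)) + D (u * r t)" for t
  proof -
    have "u * exp ((\<i> * complex_of_real t) *\<^sub>C h)
        = u + complex_of_real t *\<^sub>C (u * (\<i> *\<^sub>C h)) + u * r t"
      by (simp add: r_def algebra_simps mult_scaleC_right scaleC_scaleC)
    then show ?thesis
      by (simp add: D_add D_scaleC smooth_add smooth_mult smooth_scaleC u h r scaleR_eq_scaleC)
  qed
  have small: "norm (D (u * r t)) \<le> K * \<bar>t\<bar>\<^sup>2" if "\<bar>t\<bar> \<le> 1" for t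
  proof -
    have N: "wiener_norm 1 ((\<i> * complex_of_real t) *\<^sub>C h) = \<bar>t\<bar> * ?N"
      by (simp add: wiener_norm_scaleC norm_mult)
    have "norm (D (u * r t)) \<le> wiener_norm 0 (D (u * r t))"
      by (intro norm_le_wiener_norm smooth_D smooth_mult u r)
    also have "\<dots> \<le> 2 * pi * wiener_norm 1 (u * r t)"
      using wiener_norm_D[OF smooth_mult[OF u r], of 0 t] by simp
    also have "\<dots> \<le> 2 * pi * (wiener_norm 1 u * wiener_norm 1 (r t))"
      by (intro mult_left_mono wiener_norm_mult u r) simp
    also have "\<dots> \<le> 2 * pi * (wiener_norm 1 u * ((\<bar>t\<bar> * ?N)\<^sup>2 * exp (\<bar>t\<bar> * ?N)))"
      using wiener_norm_exp_remainder[OF smooth_scaleC[OF h], of 1 "\<i> * complex_of_real t"]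
      unfolding N r_def[symmetric] by (intro mult_left_mono) auto
    also have "\<dots> \<le> 2 * pi * (wiener_norm 1 u * ((\<bar>t\<bar> * ?N)\<^sup>2 * exp ?N))"
      using mult_right_mono[OF that, of ?N] by (intro mult_left_mono) auto
    finally show ?thesis by (simp add: K_def power_mult_distrib ac_simps)
  qed
  have r0: "D (u * r 0) = 0" using small[of 0] by simp
  show ?thesis
    unfolding has_vector_derivative_def
  proof (rule has_derivativeI_sandwich[where e = 1 and H = "\<lambda>t. K * \<bar>t\<bar>"])
    fix t :: real assume "t \<noteq> 0" "dist t 0 < 1"
    then have "norm (D (u * r t)) / \<bar>t\<bar> \<le> K * \<bar>t\<bar>"
      using small[of t] by (simp add: divide_le_eq power2_eq_square mult.assoc)
    then show "norm (D (u * exp ((\<i> * complex_of_real t) *\<^sub>C h))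
        - D (u * exp ((\<i> * complex_of_real 0) *\<^sub>C h)) - (t - 0) *\<^sub>R D (u * (\<i> *\<^sub>C h))) / norm (t - 0)
        \<le> K * \<bar>t\<bar>"
      unfolding expand by (simp add: r0)
  next
    show "((\<lambda>t. K * \<bar>t\<bar>) \<longlongrightarrow> 0) (at 0)"
      by (rule tendsto_eq_intros refl | simp)+
  qed (simp_all add: bounded_linear_scaleR_left)
qed

text \<open>
  The product rule gives twice the real part of \<open>\<tau>((D u)\<^sup>* D (u i h))\<close>, and integration by parts
  moves the outer \<open>D\<close> to the other factor.
\<close>

lemma energy_term_has_derivative:
  assumes u: "u \<in> smooth U V" and h: "h \<in> smooth U V"
  shows "((\<lambda>t. Re (\<tau> (star (D (u * exp ((\<i> * complex_of_real t) *\<^sub>C h)))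
      * D (u * exp ((\<i> * complex_of_real t) *\<^sub>C h)))))
    has_real_derivative - 2 * Re (\<i> * \<tau> (star (D (D u)) * u * h))) (at 0)"
proof -
  let ?f = "\<lambda>t. D (u * exp ((\<i> * complex_of_real t) *\<^sub>C h))" and ?v = "D (u * (\<i> *\<^sub>C h))"
  note f = D_exp_has_vector_derivative[OF u h]
  note sf = bounded_linear.has_vector_derivative[OF bounded_linear_star f]
  have "((\<lambda>t. Re (\<tau> (star (?f t) * ?f t))) has_vector_derivative
      Re (\<tau> (star (?f 0) * ?v + star ?v * ?f 0))) (at 0)"
    by (intro bounded_linear.has_vector_derivative[OF bounded_linear_Re]
        bounded_linear.has_vector_derivative[OF bounded_linear_trace] has_vector_derivative_mult f sf)
  moreover have "Re (\<tau> (star (?f 0) * ?v + star ?v * ?f 0)) = - 2 * Re (\<i> * \<tau> (star (D (D u)) * u * h))"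
  proof -
    have uh: "u * (\<i> *\<^sub>C h) \<in> smooth U V" and Du: "star (D u) \<in> smooth U V"
      by (intro smooth_mult smooth_scaleC smooth_star smooth_D u h)+
    have "\<tau> (star ?v * D u) = cnj (\<tau> (star (D u) * ?v))"
      using tracial_state_star[OF tracial_state, of "star (D u) * ?v"]
      by (simp add: star_mult star_star)
    then have "Re (\<tau> (star (D u) * ?v + star ?v * D u)) = 2 * Re (\<tau> (star (D u) * ?v))"
      by (simp add: trace_add)
    also have "\<tau> (star (D u) * ?v) = - \<tau> (D (star (D u)) * (u * (\<i> *\<^sub>C h)))"
      using trace_D[OF smooth_mult[OF Du uh]] D_mult[OF Du uh]
      by (simp add: trace_add add_eq_0_iff)
    also have "\<dots> = - (\<i> * \<tau> (star (D (D u)) * u * h))"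
      by (simp add: D_star smooth_D u mult_scaleC_right trace_scaleC mult.assoc)
    finally show ?thesis by simp
  qed
  ultimately show ?thesis by (simp add: has_real_derivative_iff_has_vector_derivative)
qed

text \<open>
  The second derivative of the constant \<open>u\<^sup>* u = 1\<close>.
\<close>

lemma D_D_unitary:
  assumes u: "u \<in> smooth U V" and "unitary u"
  shows "star (D (D u)) * u + 2 *\<^sub>R (star (D u) * D u) + star u * D (D u) = 0"
proof -
  have su: "star u \<in> smooth U V" and Du: "D u \<in> smooth U V" and sDu: "star (D u) \<in> smooth U V"
    by (intro smooth_star smooth_D u)+
  have "0 = D (D (star u * u))"
    using assms(2) D_scaleC[OF smooth_zero, of 0] by (simp add: unitary_def D_one)
  also have "\<dots> = D (star (D u) * u + star u * D u)"
    by (simp add: D_mult su u D_star)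
  also have "\<dots> = star (D (D u)) * u + star (D u) * D u + (star (D u) * D u + star u * D (D u))"
    by (simp add: D_add D_mult D_star smooth_mult su u Du sDu)
  finally show ?thesis by (simp add: scaleR_2 algebra_simps)
qed

end

section \<open>Harmonic unitaries\<close>

context irrational_rotation
begin

sublocale d1: rotation_derivation U V q \<tau> fst
  by unfold_locales (simp_all add: weight_def)

sublocale d2: rotation_derivation U V q \<tau> snd
  by unfold_locales (simp_all add: weight_def)

lemma delta1_eq: "x \<in> smooth U V \<Longrightarrow> \<delta>\<^sub>1 U V x = d1.D x"
  by (simp add: \<delta>\<^sub>1_def d1.D_def series_term_eq coeffs_eq case_prod_beta')

lemma delta2_eq: "x \<in> smooth U V \<Longrightarrow> \<delta>\<^sub>2 U V x = d2.D x"
  by (simp add: \<delta>\<^sub>2_def d2.D_def series_term_eq coeffs_eq case_prod_beta')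

lemma laplacian_eq:
  "x \<in> smooth U V \<Longrightarrow> laplacian U V x = d1.D (d1.D x) + d2.D (d2.D x)"
  by (simp add: laplacian_def delta1_eq delta2_eq d1.smooth_D d2.smooth_D)

lemma smooth_laplacian: "x \<in> smooth U V \<Longrightarrow> laplacian U V x \<in> smooth U V"
  by (simp add: laplacian_eq smooth_add d1.smooth_D d2.smooth_D)

lemma smooth_exp: "x \<in> smooth U V \<Longrightarrow> exp x \<in> smooth U V"
  using smooth_add[OF smooth_add[OF smooth_one] smooth_exp_remainder, of x x] by simp

definition gradient_square :: "'a \<Rightarrow> 'a" where
  "gradient_square u = star (\<delta>\<^sub>1 U V u) * \<delta>\<^sub>1 U V u + star (\<delta>\<^sub>2 U V u) * \<delta>\<^sub>2 U V u"

lemma star_gradient_square: "star (gradient_square u) = gradient_square u"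
  by (simp add: gradient_square_def star_add star_mult star_star)

text \<open>
  The left-hand side of the harmonicity equation, named after the tension field of a map
  between Riemannian manifolds, whose vanishing characterizes harmonic maps.
\<close>

definition tension :: "'a \<Rightarrow> 'a" where
  "tension u = star u * laplacian U V u + gradient_square u"

lemma smooth_tension: "u \<in> smooth U V \<Longrightarrow> tension u \<in> smooth U V"
  by (simp add: tension_def gradient_square_def delta1_eq delta2_eq
      smooth_add smooth_mult smooth_star smooth_laplacian d1.smooth_D d2.smooth_D)

lemma star_laplacian_mult:
  assumes u: "u \<in> smooth U V" and "unitary u"
  shows "star (laplacian U V u) * u = - tension u - gradient_square u"
proof -
  have "star (laplacian U V u) * u + 2 *\<^sub>R gradient_square u + star u * laplacian U V u
    = (star (d1.D (d1.D u)) * u + 2 *\<^sub>R (star (d1.D u) * d1.D u) + star u * d1.D (d1.D u))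
    + (star (d2.D (d2.D u)) * u + 2 *\<^sub>R (star (d2.D u) * d2.D u) + star u * d2.D (d2.D u))"
    by (simp add: gradient_square_def laplacian_eq delta1_eq delta2_eq u star_add algebra_simps)
  also have "\<dots> = 0"
    by (simp only: d1.D_D_unitary[OF assms] d2.D_D_unitary[OF assms] add_0)
  finally show ?thesis by (simp add: tension_def scaleR_2 algebra_simps add_eq_0_iff)
qed

lemma star_tension:
  assumes "u \<in> smooth U V" and "unitary u"
  shows "star (tension u) = - tension u"
  using star_laplacian_mult[OF assms]
  by (subst tension_def) (simp add: star_add star_mult star_star star_gradient_square)

lemma Im_trace_mult_selfadjoint:
  assumes "star a = a" "star b = b"
  shows "Im (\<tau> (a * b)) = 0"
proof -
  have "cnj (\<tau> (a * b)) = \<tau> (a * b)"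
    using tracial_state_star[OF tracial_state, of "a * b"] trace_commute[of a b]
    by (simp add: star_mult assms)
  then show ?thesis by (simp add: complex_eq_iff)
qed

lemma energy_has_derivative:
  assumes u: "u \<in> smooth U V" and "unitary u" and h: "h \<in> smooth U V" "star h = h"
  shows "((\<lambda>t. energy U V \<tau> (u * exp ((\<i> * complex_of_real t) *\<^sub>C h)))
    has_real_derivative Re (\<i> * \<tau> (tension u * h))) (at 0)"
proof -
  let ?w = "\<lambda>t. u * exp ((\<i> * complex_of_real t) *\<^sub>C h)"
  have w: "?w t \<in> smooth U V" for t
    by (intro smooth_mult smooth_exp smooth_scaleC u h)
  have energy: "energy U V \<tau> (?w t) = 1/2 * (Re (\<tau> (star (d1.D (?w t)) * d1.D (?w t)))
      + Re (\<tau> (star (d2.D (?w t)) * d2.D (?w t))))" for t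
    unfolding energy_def by (simp only: delta1_eq[OF w] delta2_eq[OF w] trace_add plus_complex.simps)
  have "((\<lambda>t. energy U V \<tau> (?w t)) has_real_derivative
      1/2 * (- 2 * Re (\<i> * \<tau> (star (d1.D (d1.D u)) * u * h))
        + - 2 * Re (\<i> * \<tau> (star (d2.D (d2.D u)) * u * h)))) (at 0)"
    unfolding energy
    by (intro DERIV_cmult DERIV_add d1.energy_term_has_derivative d2.energy_term_has_derivative u h)
  moreover have "1/2 * (- 2 * Re (\<i> * \<tau> (star (d1.D (d1.D u)) * u * h))
        + - 2 * Re (\<i> * \<tau> (star (d2.D (d2.D u)) * u * h)))
      = - Re (\<i> * \<tau> (star (laplacian U V u) * u * h))"
    by (simp add: laplacian_eq u star_add distrib_right trace_add)
  moreover have "\<dots> = Re (\<i> * \<tau> (tension u * h))"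
    using Im_trace_mult_selfadjoint[OF star_gradient_square h(2), of u]
    by (simp add: star_laplacian_mult[OF assms(1,2)] left_diff_distrib trace_diff trace_minus)
  ultimately show ?thesis by simp
qed

text \<open>
  The tension is skew-adjoint, so \<open>i\<close> times it is an admissible direction of variation; along
  it the derivative of the energy is the squared trace norm of the tension.
\<close>

lemma harmonic_iff_tension_zero:
  assumes u: "u \<in> smooth U V" and unitary: "unitary u"
  shows "harmonic U V \<tau> u \<longleftrightarrow> tension u = 0"
proof
  assume harmonic: "harmonic U V \<tau> u"
  define h where "h = \<i> *\<^sub>C tension u"
  have h: "h \<in> smooth U V" "star h = h"
    by (simp_all add: h_def smooth_scaleC smooth_tension u star_scaleC star_tension[OF u unitary]
        scaleC_minus_left scaleC_minus_right)
  have "((\<lambda>t. energy U V \<tau> (u * exp ((\<i> * complex_of_real t) *\<^sub>C h)))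
      has_real_derivative 0) (at 0)"
    using harmonic h by (simp add: harmonic_def)
  then have "Re (\<i> * \<tau> (tension u * h)) = 0"
    using energy_has_derivative[OF u unitary h] DERIV_unique by blast
  moreover have "\<i> * \<tau> (tension u * h) = \<tau> (star (tension u) * tension u)"
    by (simp add: h_def star_tension[OF u unitary] mult_scaleC_right trace_scaleC trace_minus)
  ultimately have "\<tau> (star (tension u) * tension u) = 0"
    using trace_nonneg[of "tension u"] by (simp add: complex_nonneg_Reals_iff complex_eq_iff)
  then show "tension u = 0" by (rule smooth_trace_faithful[OF smooth_tension[OF u]])
next
  assume "tension u = 0"
  then have "((\<lambda>t. energy U V \<tau> (u * exp ((\<i> * complex_of_real t) *\<^sub>C h)))
      has_real_derivative 0) (at 0)" if "h \<in> smooth U V" "star h = h" for h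
    using energy_has_derivative[OF u unitary that] by simp
  then show "harmonic U V \<tau> u"
    using u unitary by (simp add: harmonic_def smooth_unitaries_def)
qed

end

lemma irrational_phase_not_root_of_unity:
  assumes "\<theta> \<notin> \<rat>" and "n \<noteq> 0"
  shows "exp (2 * pi * \<i> * complex_of_real \<theta>) powi n \<noteq> 1"
proof
  assume eq: "exp (2 * pi * \<i> * complex_of_real \<theta>) powi n = 1"
  have "exp (2 * pi * \<i> * complex_of_real \<theta>) = cis (2 * pi * \<theta>)"
    by (simp add: cis_conv_exp ac_simps)
  with eq have "cis (real_of_int n * (2 * pi * \<theta>)) = 1"
    by (simp add: cis_power_int)
  then have "cos (real_of_int n * (2 * pi * \<theta>)) = 1"
    by (simp add: complex_eq_iff)
  then obtain k :: int where "real_of_int n * (2 * pi * \<theta>) = real_of_int k * 2 * pi"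
    using cos_one_2pi_int by blast
  then have "real_of_int n * \<theta> = real_of_int k" by simp
  then have "\<theta> = real_of_int k / real_of_int n"
    using \<open>n \<noteq> 0\<close> by (simp add: field_simps)
  then show False using \<open>\<theta> \<notin> \<rat>\<close> by simp
qed

theorem theorem5p3:
  fixes \<theta> :: real and U V u :: "'a::cstar_algebra" and \<tau> :: "'a \<Rightarrow> complex"
  assumes "\<theta> \<notin> \<rat>"
    and "rotation_algebra \<theta> U V"
    and "tracial_state \<tau>"
    and "u \<in> smooth U V" and "unitary u"
  shows "harmonic U V \<tau> u \<longleftrightarrow>
    star u * laplacian U V u
      + star (\<delta>\<^sub>1 U V u) * \<delta>\<^sub>1 U V u
      + star (\<delta>\<^sub>2 U V u) * \<delta>\<^sub>2 U V u = 0"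
proof -
  interpret irrational_rotation U V "exp (2 * pi * \<i> * \<theta>)" \<tau>
  proof
    show "cmod (exp (2 * pi * \<i> * \<theta>)) = 1" by simp
    show "exp (2 * pi * \<i> * \<theta>) powi n \<noteq> 1" if "n \<noteq> 0" for n
      by (rule irrational_phase_not_root_of_unity[OF \<open>\<theta> \<notin> \<rat>\<close> that])
  qed (use assms(2,3) in \<open>simp_all add: rotation_algebra_def\<close>)
  show ?thesis
    using harmonic_iff_tension_zero[OF assms(4,5)]
    by (simp add: tension_def gradient_square_def add.assoc)
qed

end
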